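(* Let $m\ge0$ and let $f$ be a bounded measurable function on $[0,\infty)^{m+1}$. Then there exists $L_m(f)\in\mathbb R$, independent of $\alpha$, such that for a.e. $\alpha\in(0,1)$, as $\eta\to0^+$, $$\frac{1}{\ln(1/\eta)}\int_\eta^1f\big(\delta_{N(\alpha,\epsilon)}(\alpha,\epsilon),\delta_{N(\alpha,\epsilon)-1}(\alpha,\epsilon),\dots,\delta_{N(\alpha,\epsilon)-m}(\alpha,\epsilon)\big)\frac{d\epsilon}{\epsilon}\to L_m(f)$$ and $$\frac{1}{\ln(1/\eta)}\int_\eta^1(-1)^{N(\alpha,\epsilon)}f\big(\delta_{N(\alpha,\epsilon)}(\alpha,\epsilon),\dots,\delta_{N(\alpha,\epsilon)-m}(\alpha,\epsilon)\big)\frac{d\epsilon}{\epsilon}\to0.$$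
   Context: For irrational $\alpha\in(0,1)$ let $T(x)=1/x-[1/x]$ be the Gauss map, $a_n=[1/T^{n-1}\alpha]$ for $n\ge1$, and define $p_0=1,p_1=0$, $q_0=0,q_1=1$, $p_{n+1}=a_np_n+p_{n-1}$, $q_{n+1}=a_nq_n+q_{n-1}$, and $d_n(\alpha)=|q_n\alpha-p_n|$ (so $d_0=1$, $d_1=\alpha$, $d_{n+1}=-a_nd_n+d_{n-1}$). For $\epsilon\in(0,1]$, $N(\alpha,\epsilon)=\inf\{n\ge0:d_n(\alpha)\le\epsilon\}$ and $\delta_n(\alpha,\epsilon)=d_n(\alpha)/\epsilon$. (When an index $N(\alpha,\epsilon)-k$ is negative, which happens only for $\epsilon$ in a fixed neighbourhood of $1$, any fixed convention may be used; it does not affect the limits.) *)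

theory Defs
  imports "HOL-Analysis.Analysis"
begin

definition gauss_map :: "real \<Rightarrow> real" where
  "gauss_map x = 1 / x - of_int \<lfloor>1 / x\<rfloor>"

definition cf_a :: "real \<Rightarrow> nat \<Rightarrow> int" where
  "cf_a \<alpha> n = \<lfloor>1 / ((gauss_map ^^ (n - 1)) \<alpha>)\<rfloor>"

fun cf_p :: "real \<Rightarrow> nat \<Rightarrow> int" where
  "cf_p \<alpha> 0 = 1"
| "cf_p \<alpha> (Suc 0) = 0"
| "cf_p \<alpha> (Suc (Suc n)) = cf_a \<alpha> (Suc n) * cf_p \<alpha> (Suc n) + cf_p \<alpha> n"

fun cf_q :: "real \<Rightarrow> nat \<Rightarrow> int" where
  "cf_q \<alpha> 0 = 0"
| "cf_q \<alpha> (Suc 0) = 1"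
| "cf_q \<alpha> (Suc (Suc n)) = cf_a \<alpha> (Suc n) * cf_q \<alpha> (Suc n) + cf_q \<alpha> n"

definition cf_d :: "real \<Rightarrow> nat \<Rightarrow> real" where
  "cf_d \<alpha> n = \<bar>of_int (cf_q \<alpha> n) * \<alpha> - of_int (cf_p \<alpha> n)\<bar>"

definition cf_N :: "real \<Rightarrow> real \<Rightarrow> nat" where
  "cf_N \<alpha> \<epsilon> = (LEAST n. cf_d \<alpha> n \<le> \<epsilon>)"

definition cf_delta :: "real \<Rightarrow> real \<Rightarrow> nat \<Rightarrow> real" where
  "cf_delta \<alpha> \<epsilon> n = cf_d \<alpha> n / \<epsilon>"

text \<open>The vector (delta_N, delta_{N-1}, ..., delta_{N-m}) as an element of
  the product space indexed by {..m}; negative indices N-k are truncated to 0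
  (natural-number subtraction), a fixed convention.\<close>
definition delta_vec :: "nat \<Rightarrow> real \<Rightarrow> real \<Rightarrow> nat \<Rightarrow> real" where
  "delta_vec m \<alpha> \<epsilon> = restrict (\<lambda>k. cf_delta \<alpha> \<epsilon> (cf_N \<alpha> \<epsilon> - k)) {..m}"

end

theory Submission
  imports Defs "HOL-Probability.Probability" "HOL-Real_Asymp.Real_Asymp"
begin

text \<open>For irrational \<open>\<alpha>\<close> one has \<open>d\<^sub>n = \<alpha> \<cdot> T \<alpha> \<cdot> \<dots> \<cdot> T\<^sup>n\<^sup>-\<^sup>1 \<alpha>\<close>, and \<open>N(\<epsilon>) = n\<close> exactly for \<open>d\<^sub>n \<le> \<epsilon> < d\<^sub>n\<^sub>-\<^sub>1\<close>.
  Since \<open>d\<epsilon>/\<epsilon>\<close> is scale invariant, the integral over such a block depends only on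
  \<open>T\<^sup>i \<alpha>\<close> with \<open>n = i + m + 1\<close>: it is \<open>G (T\<^sup>i \<alpha>)\<close> for a fixed function \<open>G\<close> dominated by a
  multiple of \<open>- ln \<circ> T\<^sup>m\<close>, so no natural extension is needed. Both the integral and \<open>ln (1/\<eta>)\<close> are
  thus Birkhoff sums, up to an error of one block, and the first limit is \<open>\<integral>G / \<integral>(- ln)\<close>
  with respect to the Gauss measure. The alternating averages vanish because \<open>T\<^sup>2\<close>
  is ergodic as well (the branches of its powers have bounded distortion), so that even and odd times contribute equally.\<close>

text \<open>The shift by m is forced by the scaling: the row at index i + m + 1 uses d_{i+1}, ...,
  d_{i+m+1}, and all of these carry the factor d_i(\<alpha>), which cancels after rescaling
  \<epsilon>. The first m blocks, the only ones where an index can be truncated at 0, disappear in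
  the averages. The Birkhoff limit for - ln also controls the incomplete last block: since - ln d_n
  / n converges, consecutive values of - ln d_n differ by o(n). For the signs, ergodicity of a map T
  alone would not suffice: T could exchange a T^2-invariant set with its complement, and the parity
  would then be visible in the limit. Ergodicity is therefore established for T^2, with words of
  even length; a T-invariant set is T^2-invariant, so T is covered. The distortion estimate makes an
  invariant set of positive measure occupy a fixed positive proportion of every cylinder, so that
  its complement has no room. It is carried out for Lebesgue measure, which has the same null sets
  in (0,1) as the Gauss measure.\<close>

section \<open>The pointwise ergodic theorem\<close>

text \<open>This is the maximum of the Birkhoff sums of lengths 0 to n, the empty sum 0 included.
  The recursion peels off the first point of the orbit, which is the form needed for comparing the
  maximum at x with that at T x.\<close>

primrec max_birkhoff_sum :: "('a \<Rightarrow> 'a) \<Rightarrow> ('a \<Rightarrow> real) \<Rightarrow> nat \<Rightarrow> 'a \<Rightarrow> real" where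
  "max_birkhoff_sum T g 0 x = 0"
| "max_birkhoff_sum T g (Suc n) x = max 0 (g x + max_birkhoff_sum T g n (T x))"

lemma max_birkhoff_sum_nonneg: "0 \<le> max_birkhoff_sum T g n x"
  by (cases n) auto

lemma max_birkhoff_sum_mono: "max_birkhoff_sum T g n x \<le> max_birkhoff_sum T g (Suc n) x"
proof (induction n arbitrary: x)
  case (Suc n)
  from Suc[of "T x"] show ?case by simp
qed simp

lemma incseq_max_birkhoff_sum: "incseq (\<lambda>n. max_birkhoff_sum T g n x)"
  by (rule incseq_SucI) (rule max_birkhoff_sum_mono)

lemma birkhoff_sum_le_max: "(\<Sum>i<n. g ((T ^^ i) x)) \<le> max_birkhoff_sum T g n x"
proof (induction n arbitrary: x)
  case (Suc n)
  have "(\<Sum>i<Suc n. g ((T ^^ i) x)) = g x + (\<Sum>i<n. g ((T ^^ i) (T x)))"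
    by (subst sum.lessThan_Suc_shift) (simp add: funpow_Suc_right del: funpow.simps)
  with Suc[of "T x"] show ?case by simp
qed simp

locale pmpt = prob_space M for M :: "'a measure" +
  fixes T :: "'a \<Rightarrow> 'a"
  assumes T_measurable [measurable]: "T \<in> measurable M M"
    and T_preserves: "distr M M T = M"
begin

lemma integrable_comp_T:
  fixes g :: "'a \<Rightarrow> real"
  assumes "integrable M g"
  shows "integrable M (\<lambda>x. g (T x))"
  using assms T_preserves by (metis T_measurable integrable_distr)

lemma integral_comp_T:
  fixes g :: "'a \<Rightarrow> real"
  assumes [measurable]: "g \<in> borel_measurable M"
  shows "(\<integral>x. g (T x) \<partial>M) = (\<integral>x. g x \<partial>M)"
  using integral_distr[of T M M g] T_preserves by simp

lemma funpow_measurable [measurable]: "(T ^^ n) \<in> measurable M M"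
  by (induction n) (auto intro: measurable_comp)

lemma max_birkhoff_sum_integrable:
  assumes "integrable M g"
  shows "integrable M (max_birkhoff_sum T g n)"
proof (induction n)
  case 0
  have "max_birkhoff_sum T g 0 = (\<lambda>x. 0)" by auto
  then show ?case by simp
next
  case (Suc n)
  have "integrable M (\<lambda>x. g x + max_birkhoff_sum T g n (T x))"
    by (intro Bochner_Integration.integrable_add assms integrable_comp_T[OF Suc])
  then have "integrable M (\<lambda>x. max 0 (g x + max_birkhoff_sum T g n (T x)))" by simp
  then show ?case by (simp cong: Bochner_Integration.integrable_cong)
qed

text \<open>Garsia's argument: with M_n for the maximum, the difference of M_n at x and at T x is at
  most g x where M_n > 0, and at most 0 elsewhere, since there M_n = 0. The integral of the
  difference vanishes by invariance of the measure.\<close>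

lemma maximal_ergodic:
  assumes g: "integrable M g"
  shows "0 \<le> (\<integral>x. indicator {x. 0 < max_birkhoff_sum T g n x} x * g x \<partial>M)"
proof -
  note [measurable] = borel_measurable_integrable[OF g]
    borel_measurable_integrable[OF max_birkhoff_sum_integrable[OF g]]
  let ?m = "max_birkhoff_sum T g n"
  have I: "integrable M ?m" "integrable M (\<lambda>x. ?m (T x))"
    using max_birkhoff_sum_integrable[OF g] integrable_comp_T by blast+
  have J: "integrable M (\<lambda>x. indicator {x. 0 < ?m x} x * g x)"
    by (rule Bochner_Integration.integrable_bound[OF g]) (auto simp: indicator_def)
  have "0 = (\<integral>x. ?m x - ?m (T x) \<partial>M)"
    using I integral_comp_T[of ?m] by simp
  also have "\<dots> \<le> (\<integral>x. indicator {x. 0 < ?m x} x * g x \<partial>M)"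
  proof (rule integral_mono)
    fix x
    show "?m x - ?m (T x) \<le> indicator {x. 0 < ?m x} x * g x"
    proof (cases "0 < ?m x")
      case True
      then obtain k where k: "n = Suc k" by (cases n) auto
      have "?m x = g x + max_birkhoff_sum T g k (T x)" using True k by (auto simp: max_def split: if_splits)
      also have "\<dots> \<le> g x + ?m (T x)" using k max_birkhoff_sum_mono by simp
      finally show ?thesis using True by simp
    next
      case False
      then show ?thesis using max_birkhoff_sum_nonneg[of T g n x] max_birkhoff_sum_nonneg[of T g n "T x"] by simp
    qed
  qed (use I J in auto)
  finally show ?thesis .
qed

end

locale ergodic_pmpt = pmpt +
  assumes ergodic: "\<And>A. A \<in> sets M \<Longrightarrow> T -` A \<inter> space M = A \<Longrightarrow> prob A = 0 \<or> prob A = 1"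
begin

text \<open>Unboundedness of the maxima is an invariant event, so it has probability 0 or 1. Were it
  1, the sets in the maximal inequality would grow to the whole space up to a null set, and the mean
  of g would be nonnegative.\<close>

lemma AE_birkhoff_sums_bounded:
  fixes g :: "'a \<Rightarrow> real"
  assumes g: "integrable M g" and neg: "(\<integral>x. g x \<partial>M) < 0"
  shows "AE x in M. \<exists>C. \<forall>n. (\<Sum>i<n. g ((T ^^ i) x)) \<le> C"
proof -
  note [measurable] = borel_measurable_integrable[OF g]
    borel_measurable_integrable[OF max_birkhoff_sum_integrable[OF g]]
  let ?m = "max_birkhoff_sum T g"
  define A where "A = {x \<in> space M. \<forall>k::nat. \<exists>n. real k < ?m n x}"
  have [measurable]: "A \<in> sets M" unfolding A_def by measurable
  \<comment> \<open>Passing between x and T x changes a positive maximum only by the finite number g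
    x, up to one step in n.\<close>
  have inv: "(\<forall>k::nat. \<exists>n. real k < ?m n (T x)) \<longleftrightarrow> (\<forall>k::nat. \<exists>n. real k < ?m n x)" for x
  proof
    assume L: "\<forall>k::nat. \<exists>n. real k < ?m n (T x)"
    show "\<forall>k::nat. \<exists>n. real k < ?m n x"
    proof
      fix k :: nat
      obtain j :: nat where j: "real k - g x < real j" using reals_Archimedean2 by blast
      with L obtain n where "real j < ?m n (T x)" by blast
      then have "real k < ?m (Suc n) x" using j by simp
      then show "\<exists>n. real k < ?m n x" ..
    qed
  next
    assume R: "\<forall>k::nat. \<exists>n. real k < ?m n x"
    show "\<forall>k::nat. \<exists>n. real k < ?m n (T x)"
    proof
      fix k :: nat
      obtain j :: nat where j: "real k + \<bar>g x\<bar> < real j" using reals_Archimedean2 by blast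
      with R obtain n where n: "real j < ?m n x" by blast
      then obtain l where "n = Suc l" by (cases n) auto
      then have "real k < ?m l (T x)" using j n by (auto simp: max_def split: if_splits)
      then show "\<exists>n. real k < ?m n (T x)" ..
    qed
  qed
  have "T -` A \<inter> space M = A"
    unfolding A_def using inv measurable_space[OF T_measurable] by auto
  then have "prob A = 0 \<or> prob A = 1" by (intro ergodic) auto
  moreover have "prob A \<noteq> 1"
  proof
    assume "prob A = 1"
    then have AE: "AE x in M. x \<in> A" by (simp add: prob_eq_1)
    have "(\<lambda>n. \<integral>x. indicator {x. 0 < ?m n x} x * g x \<partial>M) \<longlonglongrightarrow> (\<integral>x. g x \<partial>M)"
    proof (rule integral_dominated_convergence[where w = "\<lambda>x. \<bar>g x\<bar>"])
      show "AE x in M. (\<lambda>n. indicator {x. 0 < ?m n x} x * g x) \<longlonglongrightarrow> g x"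
        using AE
      proof eventually_elim
        case (elim x)
        then obtain n where n: "real 0 < ?m n x" unfolding A_def by blast
        have "eventually (\<lambda>k. indicator {x. 0 < ?m k x} x * g x = g x) sequentially"
          using eventually_ge_at_top[of n]
        proof eventually_elim
          case (elim k)
          then have "?m n x \<le> ?m k x" using incseq_max_birkhoff_sum[of T g x] by (simp add: incseq_def)
          with n show ?case by simp
        qed
        then show ?case by (rule tendsto_eventually)
      qed
    qed (use g in \<open>auto simp: indicator_def\<close>)
    then have "0 \<le> (\<integral>x. g x \<partial>M)"
      by (rule LIMSEQ_le_const) (use maximal_ergodic[OF g] in auto)
    with neg show False by simp
  qed
  ultimately have "prob A = 0" by simp
  then have "AE x in M. x \<notin> A" by (simp add: prob_eq_0)
  then show ?thesis
  proof (rule AE_mp, intro AE_I2 impI)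
    fix x assume "x \<in> space M" "x \<notin> A"
    then obtain k :: nat where k: "\<And>n. ?m n x \<le> real k" unfolding A_def by (auto simp: not_less)
    then show "\<exists>C. \<forall>n. (\<Sum>i<n. g ((T ^^ i) x)) \<le> C"
      using birkhoff_sum_le_max[of g T x] order_trans by blast
  qed
qed

text \<open>The function g minus its mean minus e/2 has negative mean, so its Birkhoff sums stay
  below a constant. The other e/2 absorbs that constant divided by n.\<close>

lemma AE_birkhoff_averages_le:
  fixes g :: "'a \<Rightarrow> real"
  assumes g: "integrable M g" and e: "0 < e"
  shows "AE x in M. eventually (\<lambda>n. (\<Sum>i<n. g ((T ^^ i) x)) / real n < (\<integral>x. g x \<partial>M) + e) sequentially"
proof -
  let ?c = "(\<integral>x. g x \<partial>M) + e / 2"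
  have "(\<integral>x. g x - ?c \<partial>M) < 0" using g e by (simp add: prob_space)
  from AE_birkhoff_sums_bounded[OF _ this] g
  have "AE x in M. \<exists>C. \<forall>n. (\<Sum>i<n. g ((T ^^ i) x) - ?c) \<le> C" by simp
  then show ?thesis
  proof eventually_elim
    case (elim x)
    then obtain C where C: "\<And>n. (\<Sum>i<n. g ((T ^^ i) x)) - real n * ?c \<le> C" by (auto simp: sum_subtractf)
    obtain k :: nat where k: "\<bar>C\<bar> / (e/2) < real k" using reals_Archimedean2 by blast
    show ?case using eventually_gt_at_top[of k]
    proof eventually_elim
      case (elim n)
      then have n: "0 < real n" "real k < real n" by auto
      have "\<bar>C\<bar> < real k * (e / 2)" using k e by (subst (asm) pos_divide_less_eq) auto
      also have "\<dots> < real n * (e / 2)" using n e by (intro mult_strict_right_mono) auto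
      finally have "\<bar>C\<bar> < real n * (e / 2)" .
      then have "(\<Sum>i<n. g ((T ^^ i) x)) < real n * ((\<integral>x. g x \<partial>M) + e)"
        using C[of n] by (simp add: algebra_simps)
      then show ?case using n by (simp add: divide_simps mult.commute)
    qed
  qed
qed

text \<open>The one-sided bound is applied to g and to - g, with tolerances 1 / (k + 1) so that only
  countably many null sets are discarded.\<close>

theorem birkhoff:
  fixes g :: "'a \<Rightarrow> real"
  assumes g: "integrable M g"
  shows "AE x in M. (\<lambda>n. (\<Sum>i<n. g ((T ^^ i) x)) / real n) \<longlonglongrightarrow> (\<integral>x. g x \<partial>M)"
proof -
  have "AE x in M. \<forall>k::nat. eventually (\<lambda>n. (\<Sum>i<n. g ((T ^^ i) x)) / real n < (\<integral>x. g x \<partial>M) + 1 / Suc k) sequentially"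
    unfolding AE_all_countable by (intro allI AE_birkhoff_averages_le g) auto
  moreover have "AE x in M. \<forall>k::nat. eventually (\<lambda>n. (\<Sum>i<n. - g ((T ^^ i) x)) / real n < (\<integral>x. - g x \<partial>M) + 1 / Suc k) sequentially"
    unfolding AE_all_countable by (intro allI AE_birkhoff_averages_le) (use g in auto)
  ultimately show ?thesis
  proof eventually_elim
    case (elim x)
    show ?case
    proof (rule LIMSEQ_I)
      fix r :: real assume "0 < r"
      then obtain k where k: "1 / real (Suc k) < r" using nat_approx_posE by blast
      have "eventually (\<lambda>n. norm ((\<Sum>i<n. g ((T ^^ i) x)) / real n - (\<integral>x. g x \<partial>M)) < r) sequentially"
        using elim(1)[rule_format, of k] elim(2)[rule_format, of k]
        by eventually_elim (use k in \<open>auto simp: sum_negf abs_less_iff\<close>)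
      then show "\<exists>no. \<forall>n\<ge>no. norm ((\<Sum>i<n. g ((T ^^ i) x)) / real n - (\<integral>x. g x \<partial>M)) < r"
        by (simp add: eventually_sequentially)
    qed
  qed
qed

end

section \<open>The Gauss measure\<close>

text \<open>The measure lives on the whole line, with no mass outside (0,1), so that measurability
  of maps is plain Borel measurability and no subspace has to be handled.\<close>

definition gauss_measure :: "real measure" where
  "gauss_measure = density lborel (\<lambda>x. ennreal (indicator {0<..<1} x * (1 / ((1 + x) * ln 2))))"

lemma sets_gauss_measure [simp, measurable_cong]: "sets gauss_measure = sets borel"
  by (simp add: gauss_measure_def)

lemma space_gauss_measure [simp]: "space gauss_measure = UNIV"
  by (simp add: gauss_measure_def)

lemma AE_gauss_measure: "(AE x in gauss_measure. P x) \<longleftrightarrow> (AE x in lborel. x \<in> {0<..<1} \<longrightarrow> P x)"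
proof -
  have "0 < ennreal (indicator {0<..<1} x * (1 / ((1 + x) * ln 2))) \<longleftrightarrow> x \<in> {0<..<1}" for x :: real
    by (auto simp: indicator_def)
  then show ?thesis unfolding gauss_measure_def by (subst AE_density) auto
qed

text \<open>Endpoints are null, so it is enough to squeeze S, within (0,1), between the open and the
  closed interval. One computation then serves half-lines, cut-off closed intervals and the whole
  line.\<close>

lemma emeasure_gauss_measure_interval:
  assumes ab: "0 \<le> a" "a \<le> b" "b \<le> 1" and S [measurable]: "S \<in> sets borel"
    and sub: "{a<..<b} \<subseteq> S" "S \<inter> {0<..<1} \<subseteq> {a..b}"
  shows "emeasure gauss_measure S = ennreal (ln (1 + b) / ln 2 - ln (1 + a) / ln 2)"
proof -
  have "emeasure gauss_measure S
      = (\<integral>\<^sup>+x. ennreal (indicator {0<..<1} x * (1 / ((1 + x) * ln 2))) * indicator S x \<partial>lborel)"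
    unfolding gauss_measure_def by (subst emeasure_density) auto
  also have "\<dots> = (\<integral>\<^sup>+x. ennreal (1 / ((1 + x) * ln 2)) * indicator {a..b} x \<partial>lborel)"
  proof (rule nn_integral_cong_AE)
    have "AE x in lborel. x \<noteq> a" "AE x in lborel. x \<noteq> b" by (rule AE_lborel_singleton)+
    then show "AE x in lborel. ennreal (indicator {0<..<1} x * (1 / ((1 + x) * ln 2))) * indicator S x
        = ennreal (1 / ((1 + x) * ln 2)) * indicator {a..b} x"
    proof eventually_elim
      case (elim x)
      show ?case
      proof (cases "x \<in> {a<..<b}")
        case True
        then have "x \<in> S" "x \<in> {0<..<1}" using sub ab by auto
        with True show ?thesis by simp
      next
        case False
        then have "x \<notin> {a..b}" using elim by auto
        then have "x \<notin> S \<or> x \<notin> {0<..<1}" using sub by auto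
        with \<open>x \<notin> {a..b}\<close> show ?thesis by auto
      qed
    qed
  qed
  also have "\<dots> = ennreal (ln (1 + b) / ln 2 - ln (1 + a) / ln 2)"
  proof (rule nn_integral_FTC_Icc)
    fix x assume "x \<in> {a..b}"
    then show "((\<lambda>x. ln (1 + x) / ln 2) has_field_derivative 1 / ((1 + x) * ln 2)) (at x)"
      using ab by (auto intro!: derivative_eq_intros simp: divide_simps)
  qed (use ab in auto)
  finally show ?thesis .
qed

lemma prob_space_gauss_measure: "prob_space gauss_measure"
proof
  show "emeasure gauss_measure (space gauss_measure) = 1"
    by (subst emeasure_gauss_measure_interval[of 0 1]) auto
qed

lemma gauss_map_measurable [measurable]: "gauss_map \<in> borel_measurable borel"
  unfolding gauss_map_def by measurable

lemma funpow_gauss_map_measurable [measurable]: "(gauss_map ^^ n) \<in> borel_measurable borel"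
  by (induction n) (auto intro: measurable_comp)

lemma gauss_map_frac: "gauss_map x = frac (1 / x)"
  by (simp add: gauss_map_def frac_def)

lemma gauss_map_nonneg: "0 \<le> gauss_map x" and gauss_map_less_1: "gauss_map x < 1"
  by (simp_all add: gauss_map_frac frac_lt_1)

text \<open>Here \<open>Suc k\<close> is the first digit: 1 / x lies in [k + 1, k + 1 + a], and a <
  1 makes the digit unambiguous.\<close>

lemma gauss_map_le_iff:
  assumes a: "0 \<le> a" "a < 1" and x: "0 < x" "x < 1"
  shows "gauss_map x \<le> a \<longleftrightarrow> (\<exists>k::nat. x \<in> {1 / (real (Suc k) + a) .. 1 / real (Suc k)})"
proof
  assume L: "gauss_map x \<le> a"
  have "1 \<le> \<lfloor>1 / x\<rfloor>" using x by (simp add: le_floor_iff)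
  then obtain k where k: "\<lfloor>1 / x\<rfloor> = int (Suc k)" by (auto simp: zle_iff_zadd)
  then have "1 / x \<le> real (Suc k) + a" using L by (simp add: gauss_map_def)
  moreover have "real (Suc k) \<le> 1 / x" using k by linarith
  ultimately have "x \<in> {1 / (real (Suc k) + a) .. 1 / real (Suc k)}"
    using x a by (simp add: field_simps)
  then show "\<exists>k::nat. x \<in> {1 / (real (Suc k) + a) .. 1 / real (Suc k)}" ..
next
  assume "\<exists>k::nat. x \<in> {1 / (real (Suc k) + a) .. 1 / real (Suc k)}"
  then obtain k :: nat where k: "x \<in> {1 / (real (Suc k) + a) .. 1 / real (Suc k)}" ..
  then have *: "1 / x \<le> real (Suc k) + a" "real (Suc k) \<le> 1 / x"
    using x a by (auto simp: field_simps)
  then have "\<lfloor>1 / x\<rfloor> = int (Suc k)" using a by (intro floor_unique) auto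
  then show "gauss_map x \<le> a" using * by (simp add: gauss_map_def)
qed

text \<open>Summing the masses of the preimage intervals \<open>[1/(k+a), 1/k]\<close> telescopes to \<open>ln (1 + a)\<close>.\<close>
lemma measure_gauss_map_vimage:
  assumes a: "0 \<le> a" "a < 1"
  shows "measure gauss_measure (gauss_map -` {..a}) = ln (1 + a) / ln 2"
proof -
  interpret prob_space gauss_measure by (rule prob_space_gauss_measure)
  \<comment> \<open>Intersecting with (0,1) removes only the endpoint 1, which belongs to the
    interval for k = 0.\<close>
  define B where "B k = {1 / (real (Suc k) + a) .. 1 / real (Suc k)} \<inter> {0<..<1}" for k
  have B [measurable]: "B k \<in> sets borel" for k unfolding B_def by auto
  have m: "measure gauss_measure (B k) = (ln (1 + 1 / real (Suc k)) - ln (1 + 1 / (real (Suc k) + a))) / ln 2" for k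
  proof -
    have le: "1 / (real (Suc k) + a) \<le> 1 / real (Suc k)" using a by (intro divide_left_mono) auto
    have "{1 / (real (Suc k) + a)<..<1 / real (Suc k)} \<subseteq> B k"
    proof
      fix x assume x: "x \<in> {1 / (real (Suc k) + a)<..<1 / real (Suc k)}"
      have "0 < 1 / (real (Suc k) + a)" "1 / real (Suc k) \<le> 1" using a by auto
      then show "x \<in> B k" using x unfolding B_def greaterThanLessThan_iff atLeastAtMost_iff Int_iff by linarith
    qed
    then have "emeasure gauss_measure (B k) = ennreal (ln (1 + 1 / real (Suc k)) / ln 2 - ln (1 + 1 / (real (Suc k) + a)) / ln 2)"
      using a le by (intro emeasure_gauss_measure_interval) (auto simp: B_def)
    moreover have "ln (1 + 1 / (real (Suc k) + a)) \<le> ln (1 + 1 / real (Suc k))"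
      using le a by (subst ln_le_cancel_iff) (auto intro!: add_pos_nonneg)
    ultimately show ?thesis by (simp add: measure_def diff_divide_distrib divide_right_mono)
  qed
  have disj: "disjoint_family B"
  proof -
    have "k = j" if "x \<in> B k" "x \<in> B j" for x k j
    proof -
      have fl: "\<lfloor>1 / x\<rfloor> = int (Suc i)" if "x \<in> B i" for i
      proof -
        have "1 / x \<le> real (Suc i) + a" "real (Suc i) \<le> 1 / x"
          using that a by (auto simp: B_def field_simps)
        then show ?thesis using a by (intro floor_unique) auto
      qed
      from fl[OF that(1)] fl[OF that(2)] show ?thesis by simp
    qed
    then show ?thesis unfolding disjoint_family_on_def by blast
  qed
  have U: "(\<Union>k. B k) = gauss_map -` {..a} \<inter> {0<..<1}"
    using gauss_map_le_iff[OF a] by (auto simp: B_def)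
  have "(\<lambda>k. measure gauss_measure (B k)) sums measure gauss_measure (\<Union>k. B k)"
    by (rule finite_measure_UNION) (use B disj in auto)
  moreover have "measure gauss_measure (\<Union>k. B k) = measure gauss_measure (gauss_map -` {..a})"
  proof (rule finite_measure_eq_AE)
    show "AE x in gauss_measure. x \<in> (\<Union>k. B k) \<longleftrightarrow> x \<in> gauss_map -` {..a}"
      unfolding AE_gauss_measure by (intro AE_I2) (auto simp: U)
    show "(\<Union>k. B k) \<in> sets gauss_measure" by simp
    show "gauss_map -` {..a} \<in> sets gauss_measure"
      using measurable_sets[OF gauss_map_measurable, of "{..a}"] by simp
  qed
  moreover have "(\<lambda>k. measure gauss_measure (B k)) sums (ln (1 + a) / ln 2)"
  proof -
    have part: "(\<Sum>k<n. measure gauss_measure (B k)) = (ln (1 + a) - ln (1 + a / real (Suc n))) / ln 2" for n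
    proof (induction n)
      case (Suc n)
      have L: "ln (1 + x / y) = ln (y + x) - ln y" if "0 < x + y" "0 < y" for x y :: real
        using that by (subst ln_divide_pos[symmetric]) (auto simp: field_simps)
      have "ln (1 + 1 / real (Suc n)) = ln (real (Suc n) + 1) - ln (real (Suc n))"
        by (rule L) auto
      moreover have "ln (1 + 1 / (real (Suc n) + a)) = ln (real (Suc n) + a + 1) - ln (real (Suc n) + a)"
        using a by (intro L) auto
      moreover have "ln (1 + a / real (Suc n)) = ln (real (Suc n) + a) - ln (real (Suc n))"
        using a by (intro L) auto
      moreover have "ln (1 + a / real (Suc (Suc n))) = ln (real (Suc (Suc n)) + a) - ln (real (Suc (Suc n)))"
        using a by (intro L) auto
      moreover have "real (Suc (Suc n)) + a = real (Suc n) + a + 1" "real (Suc (Suc n)) = real (Suc n) + 1" by simp_all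
      ultimately show ?case unfolding sum.lessThan_Suc Suc.IH m[of n] by (simp only: add_divide_distrib diff_divide_distrib)
    qed simp
    have "(\<lambda>n. (ln (1 + a) - ln (1 + a / real (Suc n))) / ln 2) \<longlonglongrightarrow> (ln (1 + a) - ln (1 + 0)) / ln 2"
      by (intro tendsto_intros LIMSEQ_Suc[OF lim_const_over_n]) auto
    then show ?thesis unfolding sums_def part by simp
  qed
  ultimately show ?thesis by (metis sums_unique2)
qed

text \<open>A probability measure on the line is determined by its distribution function. Outside
  [0,1) both functions are constant, and on [0,1) the masses are those just computed.\<close>

lemma distr_gauss_map: "distr gauss_measure gauss_measure gauss_map = gauss_measure"
proof -
  interpret prob_space gauss_measure by (rule prob_space_gauss_measure)
  have T [measurable]: "gauss_map \<in> measurable gauss_measure gauss_measure"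
    using gauss_map_measurable by (simp cong: measurable_cong_sets)
  interpret D: prob_space "distr gauss_measure gauss_measure gauss_map"
    by (rule prob_space_distr) fact
  have "real_distribution gauss_measure" "real_distribution (distr gauss_measure gauss_measure gauss_map)"
    by unfold_locales auto
  moreover have "cdf (distr gauss_measure gauss_measure gauss_map) a = cdf gauss_measure a" for a
  proof -
    have *: "cdf (distr gauss_measure gauss_measure gauss_map) a = measure gauss_measure (gauss_map -` {..a})"
      unfolding cdf_def by (subst measure_distr) auto
    consider "a < 0" | "0 \<le> a" "a < 1" | "1 \<le> a" by linarith
    then show ?thesis
    proof cases
      case 1
      then have "\<not> gauss_map x \<le> a" for x using gauss_map_nonneg[of x] by linarith
      then have "gauss_map -` {..a} = {}" by auto
      moreover have "measure gauss_measure {..a} = measure gauss_measure {}"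
        by (rule finite_measure_eq_AE) (use 1 in \<open>auto simp: AE_gauss_measure\<close>)
      ultimately show ?thesis unfolding * by (simp add: cdf_def)
    next
      case 2
      have "emeasure gauss_measure {..a} = ennreal (ln (1 + a) / ln 2 - ln (1 + 0) / ln 2)"
        by (rule emeasure_gauss_measure_interval) (use 2 in auto)
      then show ?thesis unfolding * measure_gauss_map_vimage[OF 2] using 2 by (simp add: cdf_def measure_def)
    next
      case 3
      then have "gauss_map -` {..a} = UNIV"
        by (auto intro: less_imp_le less_le_trans[OF gauss_map_less_1])
      moreover have "measure gauss_measure {..a} = measure gauss_measure UNIV"
        by (rule finite_measure_eq_AE) (use 3 in \<open>auto simp: AE_gauss_measure\<close>)
      ultimately show ?thesis unfolding * by (simp add: cdf_def)
    qed
  qed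
  ultimately show ?thesis by (intro cdf_unique) auto
qed

interpretation gauss: pmpt gauss_measure gauss_map
proof (intro pmpt.intro pmpt_axioms.intro)
  show "gauss_map \<in> measurable gauss_measure gauss_measure"
    using gauss_map_measurable by (simp cong: measurable_cong_sets)
qed (use prob_space_gauss_measure distr_gauss_map in auto)

section \<open>Cylinders and ergodicity\<close>

text \<open>A set of full measure in (0,1) that the Gauss map sends into itself: on it no orbit
  reaches 0 and all digits are positive.\<close>

definition unit_irrationals :: "real set" where
  "unit_irrationals = {0<..<1} - \<rat>"

lemma unit_irrationals_borel [measurable]: "unit_irrationals \<in> sets borel"
  unfolding unit_irrationals_def using countable_rat by (intro sets.Diff) (auto intro: sets.countable)

lemma unit_irrationalsD: "x \<in> unit_irrationals \<Longrightarrow> 0 < x \<and> x < 1"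
  by (simp add: unit_irrationals_def)

lemma AE_unit_irrationals: "AE x in lborel. x \<in> {0<..<1} \<longrightarrow> x \<in> unit_irrationals"
proof -
  have "AE x in lborel. x \<notin> (\<rat> :: real set)"
    by (intro AE_not_in countable_imp_null_set_lborel countable_rat)
  then show ?thesis by eventually_elim (auto simp: unit_irrationals_def)
qed

lemma gauss_map_unit_irrationals:
  assumes "x \<in> unit_irrationals"
  shows "gauss_map x \<in> unit_irrationals"
proof -
  have "gauss_map x \<notin> \<rat>"
  proof
    assume "gauss_map x \<in> \<rat>"
    then have "gauss_map x + of_int \<lfloor>1 / x\<rfloor> \<in> \<rat>" by (intro Rats_add) auto
    then have "1 / x \<in> \<rat>" by (simp add: gauss_map_def)
    from Rats_divide[OF Rats_1 this] show False using assms by (simp add: unit_irrationals_def)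
  qed
  then show ?thesis
    using gauss_map_nonneg[of x] gauss_map_less_1[of x] by (cases "gauss_map x = 0") (auto simp: unit_irrationals_def)
qed

lemma funpow_gauss_map_unit_irrationals:
  "x \<in> unit_irrationals \<Longrightarrow> (gauss_map ^^ n) x \<in> unit_irrationals"
  by (induction n) (auto intro: gauss_map_unit_irrationals)

lemma unit_irrationals_expand:
  assumes "x \<in> unit_irrationals"
  shows "0 < nat \<lfloor>1 / x\<rfloor>" and "1 / (real (nat \<lfloor>1 / x\<rfloor>) + gauss_map x) = x"
proof -
  have "1 \<le> \<lfloor>1 / x\<rfloor>" using unit_irrationalsD[OF assms] by (simp add: le_floor_iff)
  then have "real (nat \<lfloor>1 / x\<rfloor>) = of_int \<lfloor>1 / x\<rfloor>" "0 < nat \<lfloor>1 / x\<rfloor>"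
    using of_nat_nat[of "\<lfloor>1 / x\<rfloor>", where 'a = real] by linarith+
  then show "0 < nat \<lfloor>1 / x\<rfloor>" "1 / (real (nat \<lfloor>1 / x\<rfloor>) + gauss_map x) = x"
    by (simp_all add: gauss_map_def)
qed

lemma gauss_map_inverse_branch:
  assumes t: "t \<in> unit_irrationals" and k: "0 < k"
  shows "1 / (real k + t) \<in> unit_irrationals"
    and "gauss_map (1 / (real k + t)) = t"
    and "nat \<lfloor>1 / (1 / (real k + t))\<rfloor> = k"
proof -
  have b: "0 < t" "t < 1" using unit_irrationalsD[OF t] by auto
  have fl: "\<lfloor>real k + t\<rfloor> = int k" using b by (intro floor_unique) auto
  then show "gauss_map (1 / (real k + t)) = t" "nat \<lfloor>1 / (1 / (real k + t))\<rfloor> = k"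
    by (auto simp: gauss_map_def)
  have "1 / (real k + t) \<notin> \<rat>"
  proof
    assume "1 / (real k + t) \<in> \<rat>"
    from Rats_diff[OF Rats_divide[OF Rats_1 this], of "real k"] show False using t by (simp add: unit_irrationals_def)
  qed
  then show "1 / (real k + t) \<in> unit_irrationals" using b k by (auto simp: unit_irrationals_def)
qed

section \<open>Words, inverse branches and cylinders\<close>

text \<open>Words list the most recent digit first, so that the inverse branches compose on the right.\<close>

primrec cf_word :: "nat \<Rightarrow> real \<Rightarrow> nat list" where
  "cf_word 0 x = []"
| "cf_word (Suc n) x = nat \<lfloor>1 / (gauss_map ^^ n) x\<rfloor> # cf_word n x"

primrec branch :: "nat list \<Rightarrow> real \<Rightarrow> real" where
  "branch [] t = t"
| "branch (k # w) t = branch w (1 / (real k + t))"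

definition cylinder :: "nat list \<Rightarrow> real set" where
  "cylinder w = {x \<in> unit_irrationals. cf_word (length w) x = w}"

lemma length_cf_word [simp]: "length (cf_word n x) = n"
  by (induction n) auto

lemma cf_word_pos: "x \<in> unit_irrationals \<Longrightarrow> 0 \<notin> set (cf_word n x)"
proof (induction n)
  case (Suc n)
  then show ?case
    using unit_irrationals_expand(1)[OF funpow_gauss_map_unit_irrationals[OF Suc.prems, of n]] by simp
qed simp

lemma cf_word_eq_mono:
  assumes "m \<le> n" "cf_word n x = cf_word n y"
  shows "cf_word m x = cf_word m y"
  using assms by (induction n rule: dec_induct) auto

lemma branch_cf_word:
  assumes "x \<in> unit_irrationals"
  shows "branch (cf_word n x) ((gauss_map ^^ n) x) = x"
proof (induction n)
  case (Suc n)
  then show ?case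
    using unit_irrationals_expand(2)[OF funpow_gauss_map_unit_irrationals[OF assms, of n]] by simp
qed simp

text \<open>Together with \<open>branch_cf_word\<close> this makes \<open>branch w\<close> a
  bijection from the irrationals of (0,1) onto \<open>cylinder w\<close>, inverse to the iterate of
  \<open>gauss_map\<close> of order \<open>length w\<close>.\<close>

lemma branch_in_cylinder:
  assumes "0 \<notin> set w" "t \<in> unit_irrationals"
  shows "branch w t \<in> cylinder w \<and> (gauss_map ^^ length w) (branch w t) = t"
  using assms
proof (induction w arbitrary: t)
  case Nil
  then show ?case by (simp add: cylinder_def)
next
  case (Cons k w)
  let ?s = "1 / (real k + t)"
  have k: "0 < k" using Cons.prems by auto
  have s: "?s \<in> unit_irrationals" "gauss_map ?s = t" "nat \<lfloor>1 / ?s\<rfloor> = k"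
    using gauss_map_inverse_branch[OF Cons.prems(2) k] by blast+
  have "branch w ?s \<in> cylinder w" "(gauss_map ^^ length w) (branch w ?s) = ?s"
    using Cons.IH[OF _ s(1)] Cons.prems by auto
  with s show ?case by (auto simp: cylinder_def)
qed

text \<open>The coefficients follow the recursion of \<open>cf_p\<close> and \<open>cf_q\<close>: a,
  b are consecutive numerators and c, d consecutive denominators, newest first, hence the
  determinant. Each further digit adds at least 1 to c + d, and this linear growth suffices to
  shrink the cylinders.\<close>

lemma branch_moebius:
  assumes "0 \<notin> set w"
  shows "\<exists>a b c d. \<bar>a * d - b * c\<bar> = 1 \<and> 0 \<le> d \<and> d \<le> c \<and> 1 \<le> c \<and> real (length w) + 1 \<le> c + d \<and>
    (\<forall>t\<ge>0. branch w t = (a + b * t) / (c + d * t))"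
  using assms
proof (induction w)
  case Nil
  show ?case by (rule exI[of _ 0], rule exI[of _ 1], rule exI[of _ 1], rule exI[of _ 0]) auto
next
  case (Cons k w)
  have k: "1 \<le> real k" using Cons.prems by (cases k) auto
  obtain a b c d where H: "\<bar>a * d - b * c\<bar> = 1" "0 \<le> d" "d \<le> c" "1 \<le> c" "real (length w) + 1 \<le> c + d"
    "\<And>t. 0 \<le> t \<Longrightarrow> branch w t = (a + b * t) / (c + d * t)"
    using Cons by auto
  have ck: "c \<le> c * real k" using H k mult_left_mono[of 1 "real k" c] by simp
  have pos: "0 < real k + t" if "0 \<le> t" for t using that k by simp
  have "branch (k # w) t = (a * real k + b + a * t) / (c * real k + d + c * t)" if t: "0 \<le> t" for t
  proof -
    have "branch (k # w) t = (a + b * (1 / (real k + t))) / (c + d * (1 / (real k + t)))"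
      using H(6)[of "1 / (real k + t)"] pos[OF t] by simp
    also have "\<dots> = ((a + b * (1 / (real k + t))) * (real k + t)) / ((c + d * (1 / (real k + t))) * (real k + t))"
      using pos[OF t] by simp
    also have "\<dots> = (a * real k + b + a * t) / (c * real k + d + c * t)"
    proof -
      have "(u + v * (1 / s)) * s = u * s + v" if "0 < s" for u v s :: real
        using that by (simp add: field_simps)
      from this[OF pos[OF t]] show ?thesis by (simp add: algebra_simps)
    qed
    finally show ?thesis .
  qed
  note branch = this
  have "(a * real k + b) * c - a * (c * real k + d) = - (a * d - b * c)" by (simp add: algebra_simps)
  then have det: "\<bar>(a * real k + b) * c - a * (c * real k + d)\<bar> = 1" using H(1) by (simp only: abs_minus)
  have "0 \<le> c" "c \<le> c * real k + d" "1 \<le> c * real k + d"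
    "real (length (k # w)) + 1 \<le> c * real k + d + c"
    using H(2-5) ck unfolding list.size by linarith+
  with det branch show ?case by blast
qed

lemma cylinder_borel [measurable]: "cylinder w \<in> sets borel"
proof -
  have "{x. cf_word n x = w} \<in> sets borel" for n w
  proof (induction n arbitrary: w)
    case (Suc n)
    show ?case
    proof (cases w)
      case (Cons k v)
      have "{x. cf_word (Suc n) x = w} = {x. nat \<lfloor>1 / (gauss_map ^^ n) x\<rfloor> = k} \<inter> {x. cf_word n x = v}"
        using Cons by auto
      moreover have "{x. nat \<lfloor>1 / (gauss_map ^^ n) x\<rfloor> = k} \<in> sets borel" by measurable
      ultimately show ?thesis using Suc[of v] by auto
    qed simp
  qed simp
  moreover have "cylinder w = unit_irrationals \<inter> {x. cf_word (length w) x = w}" by (auto simp: cylinder_def)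
  ultimately show ?thesis by auto
qed

lemma cylinder_subset: "cylinder w \<subseteq> {0<..<1}"
  using unit_irrationalsD by (auto simp: cylinder_def)

text \<open>The centre a / c is the value of the branch at t = 0. The difference from it is, up to
  sign, t divided by c (c + d t), because the determinant is 1 or -1.\<close>

lemma cylinder_bound:
  assumes H: "\<bar>a * d - b * c\<bar> = 1" "0 \<le> d" "1 \<le> c"
    "\<And>t. 0 \<le> t \<Longrightarrow> branch w t = (a + b * t) / (c + d * t)"
    and x: "x \<in> cylinder w"
  shows "\<bar>x - a / c\<bar> \<le> 1 / c\<^sup>2"
proof -
  define t where "t = (gauss_map ^^ length w) x"
  have xI: "x \<in> unit_irrationals" "cf_word (length w) x = w" using x by (auto simp: cylinder_def)
  have t: "0 < t" "t < 1" using unit_irrationalsD[OF funpow_gauss_map_unit_irrationals[OF xI(1)]] by (auto simp: t_def)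
  have x: "x = (a + b * t) / (c + d * t)"
    using branch_cf_word[OF xI(1), of "length w"] H(4)[of t] t xI(2) by (simp add: t_def)
  have p: "0 < c + d * t" "c \<le> c + d * t" using H t by (auto intro: add_pos_nonneg)
  have "x - a / c = - (a * d - b * c) * t / (c * (c + d * t))"
    unfolding x using p(1) H(3) by (simp add: divide_simps) (simp add: algebra_simps)
  then have "\<bar>x - a / c\<bar> = t / (c * (c + d * t))"
    using H(1) p H(3) t by (simp add: abs_mult del: minus_diff_eq)
  also have "\<dots> \<le> 1 / (c * c)"
    using t p H(3) by (intro frac_le mult_left_mono) auto
  finally show ?thesis by (simp add: power2_eq_square)
qed

text \<open>Both points lie within 1 / c^2 of a / c, and d \<le> c gives c \<ge> (c + d) / 2; this
  is the origin of the 4.\<close>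

lemma cylinder_dist_le:
  assumes "x \<in> cylinder w" "y \<in> cylinder w"
  shows "dist x y \<le> 4 / (real (length w) + 1)"
proof -
  have "0 \<notin> set w" using cf_word_pos[of x "length w"] assms by (auto simp: cylinder_def)
  then obtain a b c d where H: "\<bar>a * d - b * c\<bar> = 1" "0 \<le> d" "d \<le> c" "1 \<le> c" "real (length w) + 1 \<le> c + d"
    "\<And>t. 0 \<le> t \<Longrightarrow> branch w t = (a + b * t) / (c + d * t)"
    using branch_moebius by blast
  have "dist x y \<le> 2 * (1 / c\<^sup>2)"
    using cylinder_bound[OF H(1,2,4,6) assms(1)] cylinder_bound[OF H(1,2,4,6) assms(2)] by (simp add: dist_real_def)
  also have "\<dots> \<le> 2 * (1 / c)" using H(4) by (simp add: power2_eq_square divide_simps)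
  also have "\<dots> \<le> 4 / (real (length w) + 1)" using H(3,4,5) by (simp add: field_simps)
  finally show ?thesis .
qed

section \<open>Distortion of the branches and ergodicity of the square\<close>

text \<open>Bounded distortion: the derivative of a branch is \<open>1/(c + d t)\<^sup>2\<close> with \<open>0 \<le> d \<le> c\<close>,
  hence varies by a factor of at most 4 over \<open>(0,1)\<close>.\<close>
lemma cylinder_distortion:
  assumes w: "0 \<notin> set w" and A [measurable]: "A \<in> sets borel"
  shows "measure lborel (A \<inter> unit_irrationals) * measure lborel (cylinder w)
    \<le> 8 * measure lborel (cylinder w \<inter> (gauss_map ^^ length w) -` A)"
proof -
  obtain a b c d where H: "\<bar>a * d - b * c\<bar> = 1" "0 \<le> d" "d \<le> c" "1 \<le> c"
    "\<And>t. 0 \<le> t \<Longrightarrow> branch w t = (a + b * t) / (c + d * t)"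
    using branch_moebius[OF w] by blast
  let ?S = "A \<inter> unit_irrationals" and ?D = "cylinder w \<inter> (gauss_map ^^ length w) -` A"
  let ?g = "\<lambda>t. (a + b * t) / (c + d * t)" and ?h = "\<lambda>t. (b * c - a * d) / (c + d * t)\<^sup>2"
  have S [measurable]: "?S \<in> sets borel" by measurable
  have D [measurable]: "?D \<in> sets borel" using measurable_sets[of "gauss_map ^^ length w" borel borel A] by simp
  have lm: "X \<in> lmeasurable" if "X \<in> sets borel" "X \<subseteq> {0<..<1}" for X :: "real set"
    using that bounded_set_imp_lmeasurable[of X] bounded_subset[of "{0<..<1}" X] by (auto simp: sets_completionI_sets)
  have lS: "?S \<in> lmeasurable" by (rule lm[OF S]) (auto simp: unit_irrationals_def)
  have lD: "?D \<in> lmeasurable" by (rule lm[OF D]) (use cylinder_subset in auto)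
  have pos: "0 < c + d * t" if "t \<in> ?S" for t
    using that H unit_irrationalsD[of t] by (auto intro!: add_pos_nonneg)
  have g: "branch w t = ?g t" if "t \<in> ?S" for t
    using that H(5) unit_irrationalsD[of t] by auto
  have img: "?g ` ?S = ?D"
  proof
    show "?g ` ?S \<subseteq> ?D"
    proof
      fix x assume "x \<in> ?g ` ?S"
      then obtain t where t: "t \<in> ?S" "x = branch w t" using g by auto
      with branch_in_cylinder[OF w, of t] show "x \<in> ?D" by auto
    qed
    show "?D \<subseteq> ?g ` ?S"
    proof
      fix x assume x: "x \<in> ?D"
      then have xI: "x \<in> unit_irrationals" "cf_word (length w) x = w" by (auto simp: cylinder_def)
      have tS: "(gauss_map ^^ length w) x \<in> ?S" using x funpow_gauss_map_unit_irrationals[OF xI(1)] by auto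
      have "x = ?g ((gauss_map ^^ length w) x)" using branch_cf_word[OF xI(1), of "length w"] g[OF tS] xI(2) by simp
      with tS show "x \<in> ?g ` ?S" by blast
    qed
  qed
  have inj: "inj_on ?g ?S"
  proof (rule inj_onI)
    fix s t assume st: "s \<in> ?S" "t \<in> ?S" "?g s = ?g t"
    then have "branch w s = branch w t" using g by simp
    moreover have "(gauss_map ^^ length w) (branch w s) = s" "(gauss_map ^^ length w) (branch w t) = t"
      using branch_in_cylinder[OF w] st by auto
    ultimately show "s = t" by metis
  qed
  have der: "(?g has_field_derivative ?h t) (at t within ?S)" if "t \<in> ?S" for t
  proof -
    have e: "(b * (c + d * t) - (a + b * t) * d) / ((c + d * t) * (c + d * t)) = ?h t"
      by (rule arg_cong2[where f = "(/)"]) (simp_all add: algebra_simps power2_eq_square)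
    have "((\<lambda>t. a + b * t) has_field_derivative b) (at t within ?S)"
      "((\<lambda>t. c + d * t) has_field_derivative d) (at t within ?S)"
      by (auto intro!: derivative_eq_intros)
    from DERIV_divide[OF this] pos[OF that] e show ?thesis by simp
  qed
  \<comment> \<open>The change of variables, applied to the constant 1, turns the measure of
    \<open>?D\<close> into the integral of the absolute derivative over \<open>?S\<close>.\<close>
  have "(\<lambda>x. 1::real) absolutely_integrable_on ?D"
    using lD by (auto simp: absolutely_integrable_on_iff_nonneg lmeasurable_iff_integrable_on)
  moreover have "integral ?D (\<lambda>x. 1::real) = measure lebesgue ?D"
    using lmeasure_integral[OF lD] by (rule sym)
  ultimately have cov: "(\<lambda>t. \<bar>?h t\<bar> *\<^sub>R (1::real)) absolutely_integrable_on ?S"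
    "integral ?S (\<lambda>t. \<bar>?h t\<bar> *\<^sub>R (1::real)) = measure lebesgue ?D"
    using has_absolute_integral_change_of_variables_real[OF _ der inj, of "\<lambda>_. 1::real" "measure lebesgue ?D"] lS
    unfolding img by (auto simp: fmeasurable_def)
  have "measure lebesgue ?S * (1 / (4 * c\<^sup>2)) = integral ?S (\<lambda>t. 1 / (4 * c\<^sup>2))"
    unfolding lmeasure_integral[OF lS] integral_mult_left[symmetric] by simp
  also have "\<dots> \<le> integral ?S (\<lambda>t. \<bar>?h t\<bar> *\<^sub>R (1::real))"
  proof (rule integral_le)
    show "(\<lambda>t. 1 / (4 * c\<^sup>2)) integrable_on ?S" by (rule integrable_on_const[OF lS])
    show "(\<lambda>t. \<bar>?h t\<bar> *\<^sub>R (1::real)) integrable_on ?S" by (rule set_lebesgue_integral_eq_integral(1)[OF cov(1)])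
    fix t assume t: "t \<in> ?S"
    have "d * t \<le> c * 1" using t H unit_irrationalsD[of t] by (intro mult_mono) auto
    then have "(c + d * t)\<^sup>2 \<le> (2 * c)\<^sup>2" using pos[OF t] by (intro power_mono) auto
    moreover have "\<bar>b * c - a * d\<bar> = 1" using H(1) by (simp add: abs_minus_commute)
    ultimately show "1 / (4 * c\<^sup>2) \<le> \<bar>?h t\<bar> *\<^sub>R 1"
      using pos[OF t] by (simp add: power_mult_distrib frac_le)
  qed
  also have "\<dots> = measure lebesgue ?D" by (rule cov)
  finally have low: "measure lborel ?S * (1 / (4 * c\<^sup>2)) \<le> measure lborel ?D"
    using S D by simp
  \<comment> \<open>From above, the cylinder is measured by its enclosing interval. The factor 8 is
    the length 2 / c^2 of that interval divided by the lower bound 1 / (4 c^2) of the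
    derivative.\<close>
  have "measure lborel (cylinder w) \<le> measure lborel {a / c - 1 / c\<^sup>2 .. a / c + 1 / c\<^sup>2}"
  proof (rule measure_mono_fmeasurable)
    show "cylinder w \<subseteq> {a / c - 1 / c\<^sup>2 .. a / c + 1 / c\<^sup>2}"
    proof
      fix x assume "x \<in> cylinder w"
      from cylinder_bound[OF H(1,2,4,5) this] show "x \<in> {a / c - 1 / c\<^sup>2 .. a / c + 1 / c\<^sup>2}"
        by (auto simp: abs_le_iff)
    qed
  qed (auto simp: fmeasurable_def emeasure_lborel_Icc_eq)
  then have "measure lborel (cylinder w) \<le> 2 / c\<^sup>2" by simp
  then have "measure lborel ?S * measure lborel (cylinder w) \<le> measure lborel ?S * (2 / c\<^sup>2)"
    by (intro mult_left_mono) auto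
  also have "\<dots> = 8 * (measure lborel ?S * (1 / (4 * c\<^sup>2)))" by simp
  also have "\<dots> \<le> 8 * measure lborel ?D" using low by linarith
  finally show ?thesis .
qed

text \<open>For an invariant A, distortion says that the proportion of A in the cylinder is at least
  an eighth of its proportion in (0,1). In \<open>ennreal\<close> this can be summed over countably
  many cylinders without summability conditions.\<close>

lemma cylinder_distortion_emeasure:
  assumes w: "0 \<notin> set w" and A [measurable]: "A \<in> sets borel"
    and inv: "(gauss_map ^^ length w) -` A = A"
  shows "emeasure lborel (A \<inter> unit_irrationals) * emeasure lborel (cylinder w)
    \<le> 8 * emeasure lborel (A \<inter> cylinder w)"
proof -
  have em: "emeasure lborel X = ennreal (measure lborel X)" if "X \<subseteq> {0<..<1}" for X :: "real set"
  proof (rule emeasure_eq_ennreal_measure)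
    have "emeasure lborel X \<le> emeasure lborel {0<..<1::real}" using that by (intro emeasure_mono) auto
    then show "emeasure lborel X \<noteq> top" by (auto simp: top_unique)
  qed
  have "measure lborel (A \<inter> unit_irrationals) * measure lborel (cylinder w) \<le> 8 * measure lborel (A \<inter> cylinder w)"
    using cylinder_distortion[OF w A] unfolding inv by (simp only: Int_commute)
  then have "ennreal (measure lborel (A \<inter> unit_irrationals) * measure lborel (cylinder w))
      \<le> ennreal (8 * measure lborel (A \<inter> cylinder w))" by (rule ennreal_leI)
  moreover have "A \<inter> unit_irrationals \<subseteq> {0<..<1}" "cylinder w \<subseteq> {0<..<1}" "A \<inter> cylinder w \<subseteq> {0<..<1}"
    using cylinder_subset[of w] by (auto simp: unit_irrationals_def)
  ultimately show ?thesis by (simp add: em ennreal_mult')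
qed

text \<open>Cylinders of a common length are disjoint, so the inequality can be summed over those
  contained in U; with growing length they exhaust the irrationals of (0,1) in U. Lengths are even
  because A is invariant under the square only.\<close>

lemma gauss_map_sq_invariant_open:
  assumes A [measurable]: "A \<in> sets borel" and inv: "(gauss_map ^^ 2) -` A = A"
    and U: "open U"
  shows "emeasure lborel (A \<inter> unit_irrationals) * emeasure lborel (U \<inter> unit_irrationals)
    \<le> 8 * emeasure lborel (A \<inter> unit_irrationals \<inter> U)"
proof -
  have inv': "(gauss_map ^^ (2 * j)) -` A = A" for j
  proof (induction j)
    case (Suc j)
    have "gauss_map ^^ (2 * Suc j) = (gauss_map ^^ 2) \<circ> (gauss_map ^^ (2 * j))"
      by (simp only: funpow_add[symmetric]) simp
    then show ?case using Suc inv by (simp only: vimage_comp[symmetric])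
  qed simp
  define W where "W j = {w. length w = 2 * j \<and> 0 \<notin> set w \<and> cylinder w \<subseteq> U}" for j
  define V where "V j = (\<Union>w\<in>W j. cylinder w)" for j
  have disj: "disjoint_family_on cylinder (W j)" for j
    by (auto simp: disjoint_family_on_def cylinder_def W_def)
  have "emeasure lborel (A \<inter> unit_irrationals) * emeasure lborel (V j)
      \<le> 8 * emeasure lborel (A \<inter> unit_irrationals \<inter> U)" for j
  proof -
    have "emeasure lborel (A \<inter> unit_irrationals) * emeasure lborel (V j)
        = (\<integral>\<^sup>+w. emeasure lborel (A \<inter> unit_irrationals) * emeasure lborel (cylinder w) \<partial>count_space (W j))"
      unfolding V_def by (subst emeasure_UN_countable) (use disj in \<open>auto simp: nn_integral_cmult\<close>)
    also have "\<dots> \<le> (\<integral>\<^sup>+w. 8 * emeasure lborel (A \<inter> cylinder w) \<partial>count_space (W j))"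
      by (intro nn_integral_mono cylinder_distortion_emeasure A) (auto simp: W_def inv')
    also have "\<dots> = 8 * (\<integral>\<^sup>+w. emeasure lborel (A \<inter> cylinder w) \<partial>count_space (W j))"
      by (simp add: nn_integral_cmult)
    also have "\<dots> = 8 * emeasure lborel (\<Union>w\<in>W j. A \<inter> cylinder w)"
    proof -
      have "disjoint_family_on (\<lambda>w. A \<inter> cylinder w) (W j)"
        using disj[of j] unfolding disjoint_family_on_def by blast
      then show ?thesis by (subst emeasure_UN_countable) simp_all
    qed
    also have "\<dots> \<le> 8 * emeasure lborel (A \<inter> unit_irrationals \<inter> U)"
      using U by (intro mult_left_mono emeasure_mono) (auto simp: W_def cylinder_def)
    finally show ?thesis .
  qed
  then have "(SUP j. emeasure lborel (A \<inter> unit_irrationals) * emeasure lborel (V j))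
      \<le> 8 * emeasure lborel (A \<inter> unit_irrationals \<inter> U)"
    by (intro SUP_least) auto
  moreover have "(SUP j. emeasure lborel (V j)) = emeasure lborel (\<Union>j. V j)"
  proof (rule SUP_emeasure_incseq)
    show "range V \<subseteq> sets lborel" unfolding V_def by (intro image_subsetI sets.countable_UN') auto
    \<comment> \<open>Refining a word shrinks its cylinder, so a point covered at level j stays
      covered.\<close>
    show "incseq V"
    proof (rule incseq_SucI, rule subsetI)
      fix j x assume "x \<in> V j"
      then obtain w where w: "length w = 2 * j" "cylinder w \<subseteq> U" "x \<in> cylinder w" by (auto simp: V_def W_def)
      then have x: "x \<in> unit_irrationals" "cf_word (2 * j) x = w" by (simp_all add: cylinder_def)
      have "cylinder (cf_word (2 * Suc j) x) \<subseteq> cylinder w"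
      proof
        fix y assume "y \<in> cylinder (cf_word (2 * Suc j) x)"
        then have y: "y \<in> unit_irrationals" "cf_word (2 * Suc j) y = cf_word (2 * Suc j) x"
          unfolding cylinder_def length_cf_word by blast+
        have "cf_word (2 * j) y = w" using cf_word_eq_mono[OF _ y(2), of "2 * j"] x(2) by simp
        then show "y \<in> cylinder w" using y(1) w(1) by (simp add: cylinder_def)
      qed
      then have "cf_word (2 * Suc j) x \<in> W (Suc j)"
        using w(2) cf_word_pos[OF x(1), of "2 * Suc j"] unfolding W_def mem_Collect_eq length_cf_word by blast
      moreover have "x \<in> cylinder (cf_word (2 * Suc j) x)"
        using x(1) unfolding cylinder_def mem_Collect_eq length_cf_word by blast
      ultimately show "x \<in> V (Suc j)" unfolding V_def by blast
    qed
  qed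
  moreover have "(\<Union>j. V j) = U \<inter> unit_irrationals"
  proof
    show "(\<Union>j. V j) \<subseteq> U \<inter> unit_irrationals" by (auto simp: V_def W_def cylinder_def)
    show "U \<inter> unit_irrationals \<subseteq> (\<Union>j. V j)"
    proof
      fix x assume x: "x \<in> U \<inter> unit_irrationals"
      then obtain r where r: "0 < r" "ball x r \<subseteq> U" using U by (auto simp: open_contains_ball)
      obtain j :: nat where j: "4 / r < real j" using reals_Archimedean2 by blast
      then have "4 < real j * r" using r by (simp add: divide_simps)
      also have "\<dots> \<le> (real (2 * j) + 1) * r" using r by (intro mult_right_mono) auto
      finally have jr: "4 / (real (2 * j) + 1) < r" by (simp add: divide_simps mult.commute)
      let ?w = "cf_word (2 * j) x"
      have xw: "x \<in> cylinder ?w" using x by (simp add: cylinder_def)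
      have "cylinder ?w \<subseteq> ball x r"
      proof
        fix y assume "y \<in> cylinder ?w"
        from cylinder_dist_le[OF xw this] jr show "y \<in> ball x r" by simp
      qed
      then have "?w \<in> W j" using r cf_word_pos[of x "2 * j"] x by (auto simp: W_def)
      with xw show "x \<in> (\<Union>j. V j)" unfolding V_def by blast
    qed
  qed
  ultimately show ?thesis by (simp flip: SUP_mult_left_ennreal)
qed

text \<open>Let A have positive measure, and let B be its complement in the irrationals of (0,1).
  For an open U containing B with U - B small, the part of A in U lies in U - B. So the product of
  the measures of A and B is arbitrarily small, and B is null.\<close>

lemma gauss_map_sq_ergodic:
  assumes A [measurable]: "A \<in> sets borel" and inv: "(gauss_map ^^ 2) -` A = A"
  shows "measure gauss_measure A = 0 \<or> measure gauss_measure A = 1"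
proof (cases "emeasure lborel (A \<inter> unit_irrationals) = 0")
  case True
  then have "AE x in lborel. x \<notin> A \<inter> unit_irrationals"
    by (intro AE_not_in) auto
  then have "AE x in gauss_measure. x \<notin> A"
    unfolding AE_gauss_measure using AE_unit_irrationals by eventually_elim auto
  then show ?thesis using gauss.prob_eq_0[of A] by simp
next
  case False
  let ?B = "unit_irrationals - A" and ?a = "emeasure lborel (A \<inter> unit_irrationals)"
  have B [measurable]: "?B \<in> sets borel" by measurable
  have "?a * emeasure lborel ?B \<le> 0"
  proof (rule ennreal_le_epsilon)
    fix e :: real assume e: "0 < e"
    obtain U where U: "open U" "?B \<subseteq> U" "emeasure lborel (U - ?B) < ennreal (e / 8)"
      using outer_regular_lborel[OF B, of "e / 8"] e by auto
    have "?a * emeasure lborel ?B \<le> ?a * emeasure lborel (U \<inter> unit_irrationals)"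
      using U by (intro mult_left_mono emeasure_mono) auto
    also have "\<dots> \<le> 8 * emeasure lborel (A \<inter> unit_irrationals \<inter> U)"
      by (rule gauss_map_sq_invariant_open[OF A inv U(1)])
    also have "\<dots> \<le> 8 * emeasure lborel (U - ?B)"
      using U by (intro mult_left_mono emeasure_mono) auto
    also have "\<dots> \<le> 8 * ennreal (e / 8)" using U by (intro mult_left_mono) auto
    also have "\<dots> = ennreal e" using e by (simp flip: ennreal_numeral ennreal_mult)
    finally show "?a * emeasure lborel ?B \<le> 0 + ennreal e" by simp
  qed
  then have "emeasure lborel ?B = 0" using False by simp
  then have "AE x in lborel. x \<notin> ?B" by (intro AE_not_in) auto
  then have "AE x in gauss_measure. x \<in> A"
    unfolding AE_gauss_measure using AE_unit_irrationals by eventually_elim auto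
  then show ?thesis using gauss.prob_eq_1[of A] by simp
qed

interpretation gauss: ergodic_pmpt gauss_measure gauss_map
proof (intro ergodic_pmpt.intro ergodic_pmpt_axioms.intro gauss.pmpt_axioms)
  fix A assume A: "A \<in> sets gauss_measure" "gauss_map -` A \<inter> space gauss_measure = A"
  then have "gauss_map -` A = A" by simp
  then have "(gauss_map ^^ 2) -` A = A" by (simp add: numeral_2_eq_2 vimage_comp[symmetric])
  then show "measure gauss_measure A = 0 \<or> measure gauss_measure A = 1"
    using A(1) by (intro gauss_map_sq_ergodic) simp_all
qed

interpretation gauss_sq: ergodic_pmpt gauss_measure "gauss_map ^^ 2"
proof (intro ergodic_pmpt.intro ergodic_pmpt_axioms.intro pmpt.intro pmpt_axioms.intro prob_space_gauss_measure)
  show "gauss_map ^^ 2 \<in> gauss_measure \<rightarrow>\<^sub>M gauss_measure" by (rule gauss.funpow_measurable)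
  have "distr gauss_measure gauss_measure (gauss_map ^^ 2)
      = distr (distr gauss_measure gauss_measure gauss_map) gauss_measure gauss_map"
    by (subst distr_distr[OF gauss.T_measurable gauss.T_measurable]) (simp add: numeral_2_eq_2)
  then show "distr gauss_measure gauss_measure (gauss_map ^^ 2) = gauss_measure"
    by (simp only: distr_gauss_map)
  fix A assume "A \<in> sets gauss_measure" "(gauss_map ^^ 2) -` A \<inter> space gauss_measure = A"
  then show "measure gauss_measure A = 0 \<or> measure gauss_measure A = 1"
    by (intro gauss_map_sq_ergodic) simp_all
qed

section \<open>Scaling blocks\<close>

text \<open>The signed errors e_n = q_n \<alpha> - p_n obey the recursion of p and q. Inductively
  e_n = - e_{n+1} / T^n \<alpha>, and 1 / T^n \<alpha> minus its digit is the next iterate.\<close>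

lemma cf_d_Suc:
  assumes "\<alpha> \<in> unit_irrationals"
  shows "cf_d \<alpha> (Suc n) = cf_d \<alpha> n * (gauss_map ^^ n) \<alpha>"
proof -
  define e where "e n = of_int (cf_q \<alpha> n) * \<alpha> - of_int (cf_p \<alpha> n)" for n
  have e: "e (Suc n) = - e n * (gauss_map ^^ n) \<alpha>" for n
  proof (induction n)
    case (Suc n)
    define t where "t = (gauss_map ^^ n) \<alpha>"
    have t: "0 < t" using unit_irrationalsD[OF funpow_gauss_map_unit_irrationals[OF assms]] by (simp add: t_def)
    have "e (Suc (Suc n)) = of_int \<lfloor>1 / t\<rfloor> * e (Suc n) + e n"
      by (simp add: e_def cf_a_def t_def algebra_simps)
    also have "\<dots> = - e (Suc n) * (1 / t - of_int \<lfloor>1 / t\<rfloor>)"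
      using Suc t by (simp add: t_def[symmetric] algebra_simps)
    also have "1 / t - of_int \<lfloor>1 / t\<rfloor> = (gauss_map ^^ Suc n) \<alpha>"
      by (simp add: gauss_map_def[of "(gauss_map ^^ n) \<alpha>"] t_def)
    finally show ?case .
  qed (simp add: e_def)
  have "0 < (gauss_map ^^ n) \<alpha>"
    using unit_irrationalsD[OF funpow_gauss_map_unit_irrationals[OF assms]] by simp
  then show ?thesis using e[of n] by (simp add: cf_d_def e_def[symmetric] abs_mult)
qed

lemma cf_d_0 [simp]: "cf_d \<alpha> 0 = 1"
  by (simp add: cf_d_def)

lemma cf_d_nonneg: "0 \<le> cf_d \<alpha> n"
  by (simp add: cf_d_def)

lemma cf_d_pos: "\<alpha> \<in> unit_irrationals \<Longrightarrow> 0 < cf_d \<alpha> n"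
  by (induction n) (use unit_irrationalsD[OF funpow_gauss_map_unit_irrationals] in \<open>auto simp: cf_d_Suc\<close>)

lemma cf_d_Suc_less:
  assumes "\<alpha> \<in> unit_irrationals"
  shows "cf_d \<alpha> (Suc n) < cf_d \<alpha> n"
  using cf_d_pos[OF assms, of n] unit_irrationalsD[OF funpow_gauss_map_unit_irrationals[OF assms, of n]]
  by (simp add: cf_d_Suc[OF assms])

lemma cf_d_antimono:
  assumes "\<alpha> \<in> unit_irrationals" "i \<le> j"
  shows "cf_d \<alpha> j \<le> cf_d \<alpha> i"
  by (rule lift_Suc_antimono_le[OF _ assms(2)]) (rule less_imp_le[OF cf_d_Suc_less[OF assms(1)]])

text \<open>Products along an orbit form a multiplicative cocycle. This is the scaling relation by
  which a distant block is moved back to a fixed index.\<close>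

lemma cf_d_add:
  assumes "\<alpha> \<in> unit_irrationals"
  shows "cf_d \<alpha> (i + l) = cf_d \<alpha> i * cf_d ((gauss_map ^^ i) \<alpha>) l"
proof (induction l)
  case (Suc l)
  have "(gauss_map ^^ (i + l)) \<alpha> = (gauss_map ^^ l) ((gauss_map ^^ i) \<alpha>)"
    by (subst add.commute) (simp add: funpow_add)
  then show ?case
    using Suc cf_d_Suc[OF assms, of "i + l"] cf_d_Suc[OF funpow_gauss_map_unit_irrationals[OF assms], of i l] by simp
qed simp

lemma ln_cf_d:
  assumes "\<alpha> \<in> unit_irrationals"
  shows "- ln (cf_d \<alpha> n) = (\<Sum>i<n. - ln ((gauss_map ^^ i) \<alpha>))"
proof (induction n)
  case (Suc n)
  have "0 < (gauss_map ^^ n) \<alpha>"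
    using unit_irrationalsD[OF funpow_gauss_map_unit_irrationals[OF assms]] by simp
  with Suc cf_d_pos[OF assms, of n] show ?case by (simp add: cf_d_Suc[OF assms] ln_mult_pos)
qed simp

lemma cf_d_measurable [measurable]: "(\<lambda>\<alpha>. cf_d \<alpha> n) \<in> borel_measurable borel"
proof -
  have a: "(\<lambda>\<alpha>. real_of_int (cf_a \<alpha> n)) \<in> borel_measurable borel" for n
    unfolding cf_a_def by measurable
  have "(\<lambda>\<alpha>. real_of_int (cf_p \<alpha> n)) \<in> borel_measurable borel" for n
    by (induction n rule: induct_nat_012) (use a in \<open>auto intro!: borel_measurable_add borel_measurable_times\<close>)
  moreover have "(\<lambda>\<alpha>. real_of_int (cf_q \<alpha> n)) \<in> borel_measurable borel" for n
    by (induction n rule: induct_nat_012) (use a in \<open>auto intro!: borel_measurable_add borel_measurable_times\<close>)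
  ultimately show ?thesis unfolding cf_d_def by measurable
qed

lemma cf_N_eqI:
  assumes "\<alpha> \<in> unit_irrationals" "cf_d \<alpha> (Suc j) \<le> \<epsilon>" "\<epsilon> < cf_d \<alpha> j"
  shows "cf_N \<alpha> \<epsilon> = Suc j"
  unfolding cf_N_def
proof (rule Least_equality)
  fix k assume "cf_d \<alpha> k \<le> \<epsilon>"
  with assms(3) have "cf_d \<alpha> k < cf_d \<alpha> j" by simp
  then show "Suc j \<le> k" using cf_d_antimono[OF assms(1), of k j] by (force simp: not_less_eq_eq[symmetric])
qed (use assms in auto)

lemma cf_N_measurable [measurable]: "cf_N \<alpha> \<in> measurable borel (count_space UNIV)"
  unfolding cf_N_def by measurable

text \<open>The absolute value keeps the row nonnegative, hence in the domain of \<open>f\<close>, for \<open>\<epsilon> < 0\<close> too.\<close>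

definition delta_row :: "nat \<Rightarrow> real \<Rightarrow> nat \<Rightarrow> real \<Rightarrow> nat \<Rightarrow> real" where
  "delta_row m \<alpha> j \<epsilon> = restrict (\<lambda>k. cf_d \<alpha> (j - k) / \<bar>\<epsilon>\<bar>) {..m}"

lemma delta_vec_eq_row: "0 < \<epsilon> \<Longrightarrow> delta_vec m \<alpha> \<epsilon> = delta_row m \<alpha> (cf_N \<alpha> \<epsilon>) \<epsilon>"
  by (simp add: delta_vec_def delta_row_def cf_delta_def)

lemma delta_row_measurable:
  "(\<lambda>(\<alpha>, \<epsilon>). delta_row m \<alpha> j \<epsilon>) \<in> measurable (borel \<Otimes>\<^sub>M borel) (PiM {..m} (\<lambda>_. restrict_space borel {0::real..}))"
  unfolding delta_row_def split_beta
  by (intro measurable_restrict measurable_restrict_space2) (auto simp: cf_d_nonneg)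

section \<open>Logarithmic integrals and Cesaro averages\<close>

lemma has_bochner_integral_inverse:
  fixes a b :: real
  assumes "0 < a" "a \<le> b"
  shows "has_bochner_integral lborel (\<lambda>\<epsilon>. indicator {a..<b} \<epsilon> * (1 / \<epsilon>)) (ln b - ln a)"
proof -
  have "has_bochner_integral lborel (\<lambda>x. (1 / x) * indicator {a..b} x) (ln b - ln a)"
    by (rule has_bochner_integral_FTC_Icc_nonneg) (use assms in \<open>auto intro!: derivative_eq_intros\<close>)
  moreover have "AE x in lborel. (1 / x) * indicator {a..b} x = indicator {a..<b} x * (1 / x)"
    using AE_lborel_singleton[of b] by eventually_elim (auto simp: indicator_def)
  ultimately show ?thesis
    by (subst has_bochner_integral_cong_AE[symmetric, where f = "\<lambda>x. (1 / x) * indicator {a..b} x"]) auto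
qed

text \<open>On (0,1) the density is at most 1 / ln 2, and - ln has the antiderivative x - x ln x
  with finite limits at both ends.\<close>

lemma integrable_neg_ln: "integrable gauss_measure (\<lambda>x. - ln x)"
proof -
  have "set_integrable lborel (einterval (ereal 0) (ereal 1)) (\<lambda>x. - ln x)"
  proof (rule interval_integral_FTC_nonneg(1))
    show "DERIV (\<lambda>x. x - x * ln x) x :> - ln x" if "ereal 0 < ereal x" "ereal x < ereal 1" for x
      using that by (auto intro!: derivative_eq_intros)
    show "isCont (\<lambda>x. - ln x) x" if "ereal 0 < ereal x" "ereal x < ereal 1" for x :: real
      using that by (auto intro!: continuous_intros)
    have "((\<lambda>x::real. x - x * ln x) \<longlongrightarrow> 0) (at_right 0)" by real_asymp
    then show "(((\<lambda>x. x - x * ln x) \<circ> real_of_ereal) \<longlongrightarrow> 0) (at_right (ereal 0))"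
      by (simp add: ereal_tendsto_simps1)
    have "((\<lambda>x::real. x - x * ln x) \<longlongrightarrow> 1 - 1 * ln 1) (at_left 1)" by (intro tendsto_intros) auto
    then show "(((\<lambda>x. x - x * ln x) \<circ> real_of_ereal) \<longlongrightarrow> 1) (at_left (ereal 1))"
      by (simp add: ereal_tendsto_simps1 del: ereal_eq_1)
  qed auto
  then have I: "integrable lborel (\<lambda>x::real. indicator {0<..<1} x * (- ln x) / ln 2)"
    by (auto simp: set_integrable_def einterval_eq)
  have "integrable lborel (\<lambda>x::real. (indicator {0<..<1} x * (1 / ((1 + x) * ln 2))) *\<^sub>R (- ln x))"
  proof (rule Bochner_Integration.integrable_bound[OF I])
    show "AE x::real in lborel. norm ((indicator {0<..<1} x * (1 / ((1 + x) * ln 2))) *\<^sub>R (- ln x))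
        \<le> norm (indicator {0<..<1} x * (- ln x) / ln 2)"
    proof (rule AE_I2)
      fix x :: real
      have "1 / ((1 + x) * ln 2) * - ln x \<le> 1 / ln 2 * - ln x" if "0 < x" "x < 1"
        using that by (intro mult_right_mono divide_left_mono) (auto intro!: mult_pos_pos)
      then show "norm ((indicator {0<..<1} x * (1 / ((1 + x) * ln 2))) *\<^sub>R (- ln x))
        \<le> norm (indicator {0<..<1} x * (- ln x) / ln 2)"
        by (auto simp: indicator_def abs_mult)
    qed
  qed measurable
  then show ?thesis unfolding gauss_measure_def
    by (subst integrable_density) (auto simp: indicator_def)
qed

text \<open>This mean is the almost sure limit of - ln d_n / n and becomes the denominator of the
  final limit.\<close>

lemma integral_neg_ln_pos: "0 < (\<integral>x. - ln x \<partial>gauss_measure)"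
proof -
  have AE: "AE x in gauss_measure. 0 < - ln x"
    unfolding AE_gauss_measure by (intro AE_I2) auto
  then have "AE x in gauss_measure. 0 \<le> - ln x" by eventually_elim simp
  moreover have "\<not> (AE x in gauss_measure. - ln x = 0)"
  proof
    assume "AE x in gauss_measure. - ln x = 0"
    with AE have "AE x in gauss_measure. False" by eventually_elim auto
    then show False by simp
  qed
  ultimately have "(\<integral>x. - ln x \<partial>gauss_measure) \<noteq> 0" "0 \<le> (\<integral>x. - ln x \<partial>gauss_measure)"
    using integral_nonneg_eq_0_iff_AE[OF integrable_neg_ln] integral_nonneg_AE[of "\<lambda>x. - ln x" gauss_measure]
    by blast+
  then show ?thesis by linarith
qed

text \<open>Finitely many initial terms contribute O(1/n). This discards the first m blocks, which
  are not of the form covered by \<open>block_shift\<close>.\<close>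

lemma cesaro_shift:
  fixes x y :: "nat \<Rightarrow> real"
  assumes y: "(\<lambda>n. (\<Sum>i<n. y i) / real n) \<longlonglongrightarrow> l" and xy: "\<And>i. x (i + k) = y i"
  shows "(\<lambda>n. (\<Sum>i<n. x i) / real n) \<longlonglongrightarrow> l"
proof (rule LIMSEQ_offset[where k = k])
  have sum: "(\<Sum>i<n + k. x i) = (\<Sum>i<k. x i) + (\<Sum>i<n. y i)" for n
    by (induction n) (auto simp: xy)
  have "(\<lambda>n. (\<Sum>i<k. x i) / real (n + k) + (\<Sum>i<n. y i) / real n * (real n / real (n + k))) \<longlonglongrightarrow> 0 + l * 1"
  proof (intro tendsto_add tendsto_mult y)
    show "(\<lambda>n. (\<Sum>i<k. x i) / real (n + k)) \<longlonglongrightarrow> 0"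
      by (intro tendsto_divide_0[OF tendsto_const] filterlim_at_top_imp_at_infinity) real_asymp
    show "(\<lambda>n. real n / real (n + k)) \<longlonglongrightarrow> 1" by real_asymp
  qed
  moreover have "(\<Sum>i<k. x i) / real (n + k) + (\<Sum>i<n. y i) / real n * (real n / real (n + k))
      = (\<Sum>i<n + k. x i) / real (n + k)" for n
    unfolding sum by (cases "n = 0") (simp_all add: add_divide_distrib)
  ultimately show "(\<lambda>n. (\<Sum>i<n + k. x i) / real (n + k)) \<longlonglongrightarrow> l" by simp
qed

text \<open>The alternating sum is twice the sum over even indices minus the full sum. About n / 2
  of the indices below n are even, so the limit is 2 (l / 2) - l = 0.\<close>

lemma alternating_cesaro:
  fixes g :: "nat \<Rightarrow> real"
  assumes all: "(\<lambda>n. (\<Sum>i<n. g i) / real n) \<longlonglongrightarrow> l"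
    and ev: "(\<lambda>n. (\<Sum>i<n. g (2 * i)) / real n) \<longlonglongrightarrow> l"
  shows "(\<lambda>n. (\<Sum>i<n. (-1) ^ i * g i) / real n) \<longlonglongrightarrow> 0"
proof -
  have sum: "(\<Sum>i<n. (-1) ^ i * g i) = 2 * (\<Sum>i<(n + 1) div 2. g (2 * i)) - (\<Sum>i<n. g i)" for n
  proof (induction n)
    case (Suc n)
    show ?case
    proof (cases "even n")
      case True
      then obtain k where "n = 2 * k" by blast
      with Suc show ?thesis by simp
    next
      case False
      then obtain k where "n = 2 * k + 1" by (rule oddE)
      with Suc show ?thesis by simp
    qed
  qed simp
  have half: "filterlim (\<lambda>n::nat. (n + 1) div 2) at_top at_top"
    unfolding filterlim_at_top eventually_sequentially
  proof (intro allI exI impI)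
    fix Z n :: nat assume "2 * Z \<le> n" then show "Z \<le> (n + 1) div 2" by simp
  qed
  have q: "(\<lambda>n. real ((n + 1) div 2) / real n) \<longlonglongrightarrow> 1 / 2"
  proof (rule tendsto_sandwich)
    show "(\<lambda>n. 1 / 2 :: real) \<longlonglongrightarrow> 1 / 2" by simp
    show "(\<lambda>n. (real n + 1) / (2 * real n)) \<longlonglongrightarrow> 1 / 2" by real_asymp
    have *: "real n \<le> 2 * real ((n + 1) div 2)" "2 * real ((n + 1) div 2) \<le> real n + 1" for n by linarith+
    show "eventually (\<lambda>n. 1 / 2 \<le> real ((n + 1) div 2) / real n) sequentially"
      using eventually_gt_at_top[of 0] by eventually_elim (use * in \<open>simp add: divide_simps\<close>)
    show "eventually (\<lambda>n. real ((n + 1) div 2) / real n \<le> (real n + 1) / (2 * real n)) sequentially"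
      using eventually_gt_at_top[of 0] by eventually_elim (use * in \<open>simp add: divide_simps\<close>)
  qed
  have "(\<lambda>n. 2 * ((\<Sum>i<(n + 1) div 2. g (2 * i)) / real ((n + 1) div 2) * (real ((n + 1) div 2) / real n))
      - (\<Sum>i<n. g i) / real n) \<longlonglongrightarrow> 2 * (l * (1 / 2)) - l"
    by (intro tendsto_intros all q filterlim_compose[OF ev half])
  moreover have "2 * ((\<Sum>i<(n + 1) div 2. g (2 * i)) / real ((n + 1) div 2) * (real ((n + 1) div 2) / real n))
      - (\<Sum>i<n. g i) / real n = (\<Sum>i<n. (-1) ^ i * g i) / real n" for n
    unfolding sum by (cases "(n + 1) div 2 = 0") (auto simp: diff_divide_distrib)
  ultimately show ?thesis by simp
qed

section \<open>Integrals over a single block\<close>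

locale delta_function =
  fixes m :: nat and f :: "(nat \<Rightarrow> real) \<Rightarrow> real" and B :: real
  assumes f_measurable [measurable]: "f \<in> borel_measurable (PiM {..m} (\<lambda>_. restrict_space borel {0::real..}))"
    and f_bound: "\<And>x. x \<in> space (PiM {..m} (\<lambda>_. restrict_space borel {0::real..})) \<Longrightarrow> \<bar>f x\<bar> \<le> B"
begin

text \<open>The index is frozen at j, which makes joint measurability in \<alpha> and \<epsilon>
  accessible; where \<open>cf_N\<close> equals j this is the true integrand. The division by
  \<epsilon> stems from the measure d\<epsilon> / \<epsilon>.\<close>

definition row_value :: "real \<Rightarrow> nat \<Rightarrow> real \<Rightarrow> real" where
  "row_value \<alpha> j \<epsilon> = f (delta_row m \<alpha> j \<epsilon>) / \<epsilon>"

text \<open>For irrational \<alpha> this integrates over exactly the \<epsilon> with N = j + 1, and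
  the half-open intervals tile (0,1). \<open>block m\<close> is the function G of the
  overview.\<close>

definition block :: "nat \<Rightarrow> real \<Rightarrow> real" where
  "block j \<alpha> = (\<integral>\<epsilon>. indicator {cf_d \<alpha> (Suc j)..<cf_d \<alpha> j} \<epsilon> * row_value \<alpha> (Suc j) \<epsilon> \<partial>lborel)"

lemma B_nonneg: "0 \<le> B"
proof -
  have "(\<lambda>k\<in>{..m}. 0) \<in> space (PiM {..m} (\<lambda>_. restrict_space borel {0::real..}))"
    by (simp add: space_PiM space_restrict_space)
  from f_bound[OF this] show ?thesis by linarith
qed

lemma row_value_measurable_pair [measurable]:
  "(\<lambda>(\<alpha>, \<epsilon>). row_value \<alpha> j \<epsilon>) \<in> borel_measurable (borel \<Otimes>\<^sub>M borel)"
proof -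
  have "(\<lambda>p. f (delta_row m (fst p) j (snd p))) \<in> borel_measurable (borel \<Otimes>\<^sub>M borel)"
    using measurable_compose[OF delta_row_measurable f_measurable, of j] by (simp add: split_beta)
  then show ?thesis unfolding row_value_def split_beta by measurable
qed

lemma row_value_measurable [measurable]: "row_value \<alpha> j \<in> borel_measurable borel"
  using measurable_compose[OF measurable_Pair1'[of \<alpha> borel borel] row_value_measurable_pair, of j] by simp

lemma row_value_bound: "0 < \<epsilon> \<Longrightarrow> \<bar>row_value \<alpha> j \<epsilon>\<bar> \<le> B * (1 / \<epsilon>)"
proof -
  assume e: "0 < \<epsilon>"
  have "delta_row m \<alpha> j \<epsilon> \<in> space (PiM {..m} (\<lambda>_. restrict_space borel {0::real..}))"
    by (auto simp: delta_row_def space_PiM space_restrict_space cf_d_nonneg)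
  from f_bound[OF this] e show ?thesis by (simp add: row_value_def divide_right_mono)
qed

text \<open>The dominating function B / \<epsilon> has integral B (ln b - ln a) over [a, b). A
  subset X is allowed so that complete and partial blocks share one estimate.\<close>

lemma integral_inverse_bound:
  assumes ab: "0 < a" "a \<le> b" and h [measurable]: "h \<in> borel_measurable borel"
    and le: "\<And>\<epsilon>. \<epsilon> \<in> {a..<b} \<Longrightarrow> \<bar>h \<epsilon>\<bar> \<le> B * (1 / \<epsilon>)"
    and X [measurable]: "X \<in> sets borel" and sub: "X \<subseteq> {a..<b}"
  shows "integrable lborel (\<lambda>\<epsilon>. indicator X \<epsilon> * h \<epsilon>)"
    and "\<bar>\<integral>\<epsilon>. indicator X \<epsilon> * h \<epsilon> \<partial>lborel\<bar> \<le> B * (ln b - ln a)"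
proof -
  have "has_bochner_integral lborel (\<lambda>\<epsilon>. B * (indicator {a..<b} \<epsilon> * (1 / \<epsilon>))) (B * (ln b - ln a))"
    by (intro has_bochner_integral_mult_right has_bochner_integral_inverse ab)
  then have I: "integrable lborel (\<lambda>\<epsilon>. B * (indicator {a..<b} \<epsilon> * (1 / \<epsilon>)))"
    "(\<integral>\<epsilon>. B * (indicator {a..<b} \<epsilon> * (1 / \<epsilon>)) \<partial>lborel) = B * (ln b - ln a)"
    by (auto simp: has_bochner_integral_iff)
  have bd: "norm (indicator X \<epsilon> * h \<epsilon>) \<le> B * (indicator {a..<b} \<epsilon> * (1 / \<epsilon>))" for \<epsilon>
  proof (cases "\<epsilon> \<in> X")
    case True
    then have "\<epsilon> \<in> {a..<b}" using sub by auto
    with le[OF this] True show ?thesis by simp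
  next
    case False
    have "0 \<le> B * (indicator {a..<b} \<epsilon> * (1 / \<epsilon>))"
      using ab B_nonneg by (auto simp: indicator_def)
    with False show ?thesis by simp
  qed
  show J: "integrable lborel (\<lambda>\<epsilon>. indicator X \<epsilon> * h \<epsilon>)"
  proof (rule Bochner_Integration.integrable_bound[OF I(1)])
    show "AE \<epsilon> in lborel. norm (indicator X \<epsilon> * h \<epsilon>) \<le> norm (B * (indicator {a..<b} \<epsilon> * (1 / \<epsilon>)))"
      using bd abs_ge_self order_trans unfolding real_norm_def by (intro AE_I2) blast
  qed measurable
  have "\<bar>\<integral>\<epsilon>. indicator X \<epsilon> * h \<epsilon> \<partial>lborel\<bar> \<le> (\<integral>\<epsilon>. norm (indicator X \<epsilon> * h \<epsilon>) \<partial>lborel)"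
    using integral_norm_bound[of lborel "\<lambda>\<epsilon>. indicator X \<epsilon> * h \<epsilon>"] by simp
  also have "\<dots> \<le> (\<integral>\<epsilon>. B * (indicator {a..<b} \<epsilon> * (1 / \<epsilon>)) \<partial>lborel)"
    by (intro integral_mono integrable_norm J I bd)
  finally show "\<bar>\<integral>\<epsilon>. indicator X \<epsilon> * h \<epsilon> \<partial>lborel\<bar> \<le> B * (ln b - ln a)" using I(2) by simp
qed

lemma block_bound:
  assumes "\<alpha> \<in> unit_irrationals"
  shows "\<bar>block j \<alpha>\<bar> \<le> B * (- ln ((gauss_map ^^ j) \<alpha>))"
proof -
  have p: "0 < cf_d \<alpha> (Suc j)" "0 < cf_d \<alpha> j" using cf_d_pos[OF assms] by auto
  have "\<bar>block j \<alpha>\<bar> \<le> B * (ln (cf_d \<alpha> j) - ln (cf_d \<alpha> (Suc j)))"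
    unfolding block_def
  proof (rule integral_inverse_bound(2))
    show "cf_d \<alpha> (Suc j) \<le> cf_d \<alpha> j" using cf_d_Suc_less[OF assms, of j] by simp
    fix \<epsilon> assume "\<epsilon> \<in> {cf_d \<alpha> (Suc j)..<cf_d \<alpha> j}"
    then show "\<bar>row_value \<alpha> (Suc j) \<epsilon>\<bar> \<le> B * (1 / \<epsilon>)" using p by (intro row_value_bound) auto
  qed (use p in auto)
  also have "ln (cf_d \<alpha> j) - ln (cf_d \<alpha> (Suc j)) = - ln ((gauss_map ^^ j) \<alpha>)"
    using ln_cf_d[OF assms, of j] ln_cf_d[OF assms, of "Suc j"] by simp
  finally show ?thesis .
qed

lemma block_measurable [measurable]: "block j \<in> borel_measurable borel"
proof -
  have "(\<lambda>(\<alpha>, \<epsilon>). indicator {cf_d \<alpha> (Suc j)..<cf_d \<alpha> j} \<epsilon> * row_value \<alpha> (Suc j) \<epsilon>) \<in> borel_measurable (borel \<Otimes>\<^sub>M lborel)"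
  proof -
    have [measurable]: "(\<lambda>p. row_value (fst p) (Suc j) (snd p)) \<in> borel_measurable (borel \<Otimes>\<^sub>M lborel)"
      using row_value_measurable_pair[of "Suc j"] by (simp add: split_beta cong: measurable_cong_sets)
    \<comment> \<open>The endpoints of the indicator depend on \<alpha>, so it is rewritten as a
      measurable predicate on the pair.\<close>
    have "(\<lambda>p. of_bool (cf_d (fst p) (Suc j) \<le> snd p \<and> snd p < cf_d (fst p) j) * row_value (fst p) (Suc j) (snd p))
        \<in> borel_measurable (borel \<Otimes>\<^sub>M lborel)" by measurable
    then show ?thesis by (simp add: split_beta indicator_def of_bool_def)
  qed
  then show ?thesis unfolding block_def by (rule lborel.borel_measurable_lebesgue_integral)
qed

text \<open>Rescaling \<open>\<epsilon> = d\<^sub>i(\<alpha>) s\<close> moves a block back to a bounded index.\<close>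
lemma block_shift:
  assumes a: "\<alpha> \<in> unit_irrationals"
  shows "block (i + m) \<alpha> = block m ((gauss_map ^^ i) \<alpha>)"
proof -
  define c \<beta> where "c = cf_d \<alpha> i" and "\<beta> = (gauss_map ^^ i) \<alpha>"
  have c: "0 < c" using cf_d_pos[OF a] by (simp add: c_def)
  have d: "cf_d \<alpha> (i + l) = c * cf_d \<beta> l" for l using cf_d_add[OF a] by (simp add: c_def \<beta>_def)
  have row: "delta_row m \<alpha> (Suc (i + m)) (c * x) = delta_row m \<beta> (Suc m) x" for x
  proof -
    have "cf_d \<alpha> (Suc (i + m) - k) / \<bar>c * x\<bar> = cf_d \<beta> (Suc m - k) / \<bar>x\<bar>" if "k \<le> m" for k
    proof -
      \<comment> \<open>Since k \<le> m, no subtraction is truncated; this is why the shift starts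
        from block m.\<close>
      have "Suc (i + m) - k = i + (Suc m - k)" using that by simp
      then show ?thesis using c d by (simp add: abs_mult)
    qed
    then show ?thesis unfolding delta_row_def by (intro restrict_ext) auto
  qed
  \<comment> \<open>The Jacobian c cancels against the 1 / (c x) contained in
    \<open>row_value\<close>.\<close>
  have "block (i + m) \<alpha> = \<bar>c\<bar> *\<^sub>R (\<integral>x. indicator {cf_d \<alpha> (Suc (i + m))..<cf_d \<alpha> (i + m)} (0 + c * x)
      * row_value \<alpha> (Suc (i + m)) (0 + c * x) \<partial>lborel)"
    unfolding block_def using c by (intro lborel_integral_real_affine) simp
  also have "\<dots> = (\<integral>x. c * (indicator {cf_d \<alpha> (Suc (i + m))..<cf_d \<alpha> (i + m)} (0 + c * x)
      * row_value \<alpha> (Suc (i + m)) (0 + c * x)) \<partial>lborel)"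
    using c by simp
  also have "\<dots> = block m \<beta>"
    unfolding block_def
  proof (rule Bochner_Integration.integral_cong)
    fix x
    have "indicator {cf_d \<alpha> (Suc (i + m))..<cf_d \<alpha> (i + m)} (0 + c * x)
        = (indicator {cf_d \<beta> (Suc m)..<cf_d \<beta> m} x :: real)"
      using c d[of m] d[of "Suc m"] by (simp add: indicator_def)
    then show "c * (indicator {cf_d \<alpha> (Suc (i + m))..<cf_d \<alpha> (i + m)} (0 + c * x)
        * row_value \<alpha> (Suc (i + m)) (0 + c * x))
      = indicator {cf_d \<beta> (Suc m)..<cf_d \<beta> m} x * row_value \<beta> (Suc m) x"
      using c row[of x] by (simp add: row_value_def)
  qed simp
  finally show ?thesis by (simp add: \<beta>_def)
qed

lemma block_integrable: "integrable gauss_measure (block m)"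
proof (rule Bochner_Integration.integrable_bound)
  have "integrable gauss_measure (\<lambda>x. - ln ((gauss_map ^^ n) x))" for n
    by (induction n) (use integrable_neg_ln gauss.integrable_comp_T in \<open>auto simp: funpow_Suc_right simp del: funpow.simps\<close>)
  then show "integrable gauss_measure (\<lambda>x. B * (- ln ((gauss_map ^^ m) x)))"
    by (intro integrable_mult_right)
  show "AE x in gauss_measure. norm (block m x) \<le> norm (B * (- ln ((gauss_map ^^ m) x)))"
    unfolding AE_gauss_measure using AE_unit_irrationals
  proof eventually_elim
    case (elim x)
    then show ?case using block_bound[of x m] by (auto intro: order_trans[OF _ abs_ge_self])
  qed
qed (use block_measurable in \<open>simp cong: measurable_cong_sets\<close>)

text \<open>The weight s treats both integrals at once: s = 1 for the plain one, s n = (-1)^n for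
  the alternating one.\<close>

definition signed_value :: "real \<Rightarrow> (nat \<Rightarrow> real) \<Rightarrow> real \<Rightarrow> real" where
  "signed_value \<alpha> s \<epsilon> = s (cf_N \<alpha> \<epsilon>) * row_value \<alpha> (cf_N \<alpha> \<epsilon>) \<epsilon>"

section \<open>The integral from \<eta> to 1 for a fixed \<alpha>\<close>

context
  fixes \<alpha> :: real and s :: "nat \<Rightarrow> real"
  assumes \<alpha>: "\<alpha> \<in> unit_irrationals" and s: "\<And>n. \<bar>s n\<bar> \<le> 1"
begin

lemma signed_value_measurable [measurable]: "signed_value \<alpha> s \<in> borel_measurable borel"
proof -
  have "(\<lambda>\<epsilon>. s n * row_value \<alpha> n \<epsilon>) \<in> borel_measurable borel" for n by measurable
  from measurable_compose_countable[OF this cf_N_measurable] show ?thesis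
    unfolding signed_value_def by simp
qed

lemma signed_value_bound: "0 < \<epsilon> \<Longrightarrow> \<bar>signed_value \<alpha> s \<epsilon>\<bar> \<le> B * (1 / \<epsilon>)"
  using row_value_bound[of \<epsilon> \<alpha> "cf_N \<alpha> \<epsilon>"] s[of "cf_N \<alpha> \<epsilon>"]
    mult_mono[of "\<bar>s (cf_N \<alpha> \<epsilon>)\<bar>" 1 "\<bar>row_value \<alpha> (cf_N \<alpha> \<epsilon>) \<epsilon>\<bar>" "B * (1 / \<epsilon>)"]
  by (simp add: signed_value_def abs_mult)

lemma signed_value_bounds:
  assumes "0 < a" "a \<le> b" "X \<in> sets borel" "X \<subseteq> {a..<b}"
  shows "integrable lborel (\<lambda>\<epsilon>. indicator X \<epsilon> * signed_value \<alpha> s \<epsilon>)"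
    and "\<bar>\<integral>\<epsilon>. indicator X \<epsilon> * signed_value \<alpha> s \<epsilon> \<partial>lborel\<bar> \<le> B * (ln b - ln a)"
  using integral_inverse_bound[OF assms(1,2) signed_value_measurable _ assms(3,4)] signed_value_bound assms(1) by auto

lemma signed_value_integral_blocks:
  "(\<integral>\<epsilon>. indicator {cf_d \<alpha> n..<1} \<epsilon> * signed_value \<alpha> s \<epsilon> \<partial>lborel) = (\<Sum>i<n. s (Suc i) * block i \<alpha>)"
proof (induction n)
  case (Suc n)
  have d: "0 < cf_d \<alpha> (Suc n)" "cf_d \<alpha> (Suc n) < cf_d \<alpha> n" "cf_d \<alpha> n \<le> 1"
    using cf_d_pos[OF \<alpha>] cf_d_Suc_less[OF \<alpha>] cf_d_antimono[OF \<alpha>, of 0 n] by auto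
  have "(\<integral>\<epsilon>. indicator {cf_d \<alpha> (Suc n)..<1} \<epsilon> * signed_value \<alpha> s \<epsilon> \<partial>lborel)
      = (\<integral>\<epsilon>. indicator {cf_d \<alpha> n..<1} \<epsilon> * signed_value \<alpha> s \<epsilon>
        + indicator {cf_d \<alpha> (Suc n)..<cf_d \<alpha> n} \<epsilon> * signed_value \<alpha> s \<epsilon> \<partial>lborel)"
    by (rule Bochner_Integration.integral_cong) (use d in \<open>auto simp: indicator_def\<close>)
  also have "\<dots> = (\<integral>\<epsilon>. indicator {cf_d \<alpha> n..<1} \<epsilon> * signed_value \<alpha> s \<epsilon> \<partial>lborel)
      + (\<integral>\<epsilon>. indicator {cf_d \<alpha> (Suc n)..<cf_d \<alpha> n} \<epsilon> * signed_value \<alpha> s \<epsilon> \<partial>lborel)"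
    by (intro Bochner_Integration.integral_add signed_value_bounds(1)[of "cf_d \<alpha> (Suc n)" 1]) (use d in auto)
  also have "(\<integral>\<epsilon>. indicator {cf_d \<alpha> (Suc n)..<cf_d \<alpha> n} \<epsilon> * signed_value \<alpha> s \<epsilon> \<partial>lborel)
      = (\<integral>\<epsilon>. s (Suc n) * (indicator {cf_d \<alpha> (Suc n)..<cf_d \<alpha> n} \<epsilon> * row_value \<alpha> (Suc n) \<epsilon>) \<partial>lborel)"
    by (rule Bochner_Integration.integral_cong)
      (auto simp: indicator_def signed_value_def cf_N_eqI[OF \<alpha>])
  also have "\<dots> = s (Suc n) * block n \<alpha>" by (simp add: block_def)
  finally show ?case using Suc by simp
qed simp

text \<open>The integral from \<eta> covers the blocks before k and a part of block k. Completing
  that block adds an integral over [d_{k+1}, \<eta>], bounded like the whole block.\<close>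

lemma interval_signed_value_error:
  assumes \<eta>: "0 < \<eta>" "cf_d \<alpha> (Suc k) \<le> \<eta>" "\<eta> < cf_d \<alpha> k"
  shows "\<bar>(LBINT \<epsilon>=\<eta>..1. signed_value \<alpha> s \<epsilon>) - (\<Sum>i<Suc k. s (Suc i) * block i \<alpha>)\<bar>
    \<le> B * (ln (cf_d \<alpha> k) - ln (cf_d \<alpha> (Suc k)))"
proof -
  have d: "0 < cf_d \<alpha> (Suc k)" "cf_d \<alpha> k \<le> 1"
    using cf_d_pos[OF \<alpha>] cf_d_antimono[OF \<alpha>, of 0 k] by auto
  have E: "(LBINT \<epsilon>=\<eta>..1. signed_value \<alpha> s \<epsilon>) = (\<integral>\<epsilon>. indicator {\<eta><..<1} \<epsilon> * signed_value \<alpha> s \<epsilon> \<partial>lborel)"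
    using \<eta> d by (simp add: interval_lebesgue_integral_def set_lebesgue_integral_def one_ereal_def einterval_eq del: ereal_eq_1)
  have "(\<integral>\<epsilon>. indicator {cf_d \<alpha> (Suc k)..<1} \<epsilon> * signed_value \<alpha> s \<epsilon> \<partial>lborel)
      = (\<integral>\<epsilon>. indicator {\<eta><..<1} \<epsilon> * signed_value \<alpha> s \<epsilon>
        + indicator {cf_d \<alpha> (Suc k)..\<eta>} \<epsilon> * signed_value \<alpha> s \<epsilon> \<partial>lborel)"
    by (rule Bochner_Integration.integral_cong) (use \<eta> d in \<open>auto simp: indicator_def\<close>)
  also have "\<dots> = (\<integral>\<epsilon>. indicator {\<eta><..<1} \<epsilon> * signed_value \<alpha> s \<epsilon> \<partial>lborel)
      + (\<integral>\<epsilon>. indicator {cf_d \<alpha> (Suc k)..\<eta>} \<epsilon> * signed_value \<alpha> s \<epsilon> \<partial>lborel)"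
    by (intro Bochner_Integration.integral_add signed_value_bounds(1)[of "cf_d \<alpha> (Suc k)" 1]) (use \<eta> d in auto)
  finally have "(LBINT \<epsilon>=\<eta>..1. signed_value \<alpha> s \<epsilon>) - (\<Sum>i<Suc k. s (Suc i) * block i \<alpha>)
      = - (\<integral>\<epsilon>. indicator {cf_d \<alpha> (Suc k)..\<eta>} \<epsilon> * signed_value \<alpha> s \<epsilon> \<partial>lborel)"
    using E signed_value_integral_blocks[of "Suc k"] by simp
  moreover have "\<bar>\<integral>\<epsilon>. indicator {cf_d \<alpha> (Suc k)..\<eta>} \<epsilon> * signed_value \<alpha> s \<epsilon> \<partial>lborel\<bar>
      \<le> B * (ln (cf_d \<alpha> k) - ln (cf_d \<alpha> (Suc k)))"
    by (rule signed_value_bounds(2)) (use \<eta> d in auto)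
  ultimately show ?thesis by simp
qed

text \<open>Both the integral and ln (1/\<eta>) are divided by the number
  \<open>Suc (K \<eta>)\<close> of blocks. With k = \<open>K \<eta>\<close>, ln (1/\<eta>) lies
  between - ln d_k and - ln d_{k+1}, both asymptotic to c k, so it is asymptotic to c k as well and
  the error of one block is o(k).\<close>

lemma tendsto_signed_average:
  assumes c: "(\<lambda>n. - ln (cf_d \<alpha> n) / real n) \<longlonglongrightarrow> c" "0 < c"
    and blocks: "(\<lambda>n. (\<Sum>i<n. s (Suc i) * block i \<alpha>) / real n) \<longlonglongrightarrow> \<Lambda>"
  shows "((\<lambda>\<eta>. (1 / ln (1 / \<eta>)) * (LBINT \<epsilon>=\<eta>..1. signed_value \<alpha> s \<epsilon>)) \<longlongrightarrow> \<Lambda> / c) (at_right 0)"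
proof -
  have "filterlim (\<lambda>n. - ln (cf_d \<alpha> n) / real n * real n) at_top sequentially"
    by (rule filterlim_tendsto_pos_mult_at_top[OF c filterlim_real_sequentially])
  then have lim: "filterlim (\<lambda>n. - ln (cf_d \<alpha> n)) at_top sequentially"
  proof (rule filterlim_cong[THEN iffD1, rotated -1])
    show "eventually (\<lambda>n. - ln (cf_d \<alpha> n) / real n * real n = - ln (cf_d \<alpha> n)) sequentially"
      using eventually_gt_at_top[of 0] by eventually_elim simp
  qed auto
  \<comment> \<open>This is the index of the block containing \<eta>. For \<eta> < 1 the subtraction
    is genuine, because d_0 = 1 forces N \<ge> 1.\<close>
  define K where "K \<eta> = cf_N \<alpha> \<eta> - 1" for \<eta>
  have K: "cf_d \<alpha> (Suc (K \<eta>)) \<le> \<eta>" "\<eta> < cf_d \<alpha> (K \<eta>)" if \<eta>: "0 < \<eta>" "\<eta> < 1" for \<eta>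
  proof -
    \<comment> \<open>Divergence of - ln d_n provides some n with d_n \<le> \<eta>, so that the
      least one in the definition of N exists.\<close>
    obtain n where "- ln \<eta> < - ln (cf_d \<alpha> n)"
      using lim unfolding filterlim_at_top_dense by (metis eventually_happens sequentially_bot)
    then have "cf_d \<alpha> n \<le> \<eta>" using \<eta> cf_d_pos[OF \<alpha>, of n] by simp
    then have N: "cf_d \<alpha> (cf_N \<alpha> \<eta>) \<le> \<eta>" unfolding cf_N_def by (rule LeastI)
    then have "cf_N \<alpha> \<eta> \<noteq> 0" using \<eta> by (metis cf_d_0 not_le)
    then have S: "Suc (K \<eta>) = cf_N \<alpha> \<eta>" by (simp add: K_def)
    then show "cf_d \<alpha> (Suc (K \<eta>)) \<le> \<eta>" using N by simp
    have "K \<eta> < cf_N \<alpha> \<eta>" using S by simp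
    then show "\<eta> < cf_d \<alpha> (K \<eta>)" unfolding cf_N_def by (auto dest: not_less_Least)
  qed
  have ev01: "eventually (\<lambda>\<eta>::real. 0 < \<eta> \<and> \<eta> < 1) (at_right 0)"
    unfolding eventually_at_right_field by (rule exI[of _ 1]) auto
  have Klim: "filterlim K at_top (at_right 0)"
    unfolding filterlim_at_top
  proof
    fix Z :: nat
    have "0 < cf_d \<alpha> Z" by (rule cf_d_pos[OF \<alpha>])
    then have "eventually (\<lambda>\<eta>. \<eta> < cf_d \<alpha> Z) (at_right 0)"
      by (auto simp: eventually_at_right_field)
    with ev01 show "eventually (\<lambda>\<eta>. Z \<le> K \<eta>) (at_right 0)"
    proof eventually_elim
      case (elim \<eta>)
      show ?case
      proof (rule ccontr)
        assume "\<not> Z \<le> K \<eta>"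
        then have "cf_d \<alpha> Z \<le> cf_d \<alpha> (Suc (K \<eta>))" by (intro cf_d_antimono[OF \<alpha>]) simp
        with K(1)[of \<eta>] elim show False by simp
      qed
    qed
  qed
  have c1: "(\<lambda>n. - ln (cf_d \<alpha> (Suc n)) / real (Suc n)) \<longlonglongrightarrow> c" by (rule LIMSEQ_Suc[OF c(1)])
  have c0: "(\<lambda>n. - ln (cf_d \<alpha> n) / real (Suc n)) \<longlonglongrightarrow> c"
  proof -
    have "(\<lambda>n. real n / real (Suc n)) \<longlonglongrightarrow> 1" by real_asymp
    from tendsto_mult[OF c(1) this]
    have "(\<lambda>n. - ln (cf_d \<alpha> n) / real n * (real n / real (Suc n))) \<longlonglongrightarrow> c" by simp
    moreover have "- ln (cf_d \<alpha> n) / real n * (real n / real (Suc n)) = - ln (cf_d \<alpha> n) / real (Suc n)" for n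
      by (cases "n = 0") simp_all
    ultimately show ?thesis by simp
  qed
  have ln_lim: "((\<lambda>\<eta>. ln (1 / \<eta>) / real (Suc (K \<eta>))) \<longlongrightarrow> c) (at_right 0)"
  proof (rule tendsto_sandwich[OF _ _ filterlim_compose[OF c0 Klim] filterlim_compose[OF c1 Klim]])
    show "eventually (\<lambda>\<eta>. - ln (cf_d \<alpha> (K \<eta>)) / real (Suc (K \<eta>)) \<le> ln (1 / \<eta>) / real (Suc (K \<eta>))) (at_right 0)"
      using ev01
    proof eventually_elim
      case (elim \<eta>)
      then have "ln \<eta> \<le> ln (cf_d \<alpha> (K \<eta>))" using K(2)[of \<eta>] by (subst ln_le_cancel_iff) auto
      then show ?case using elim by (intro divide_right_mono) (auto simp: ln_div)
    qed
    show "eventually (\<lambda>\<eta>. ln (1 / \<eta>) / real (Suc (K \<eta>)) \<le> - ln (cf_d \<alpha> (Suc (K \<eta>))) / real (Suc (K \<eta>))) (at_right 0)"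
      using ev01
    proof eventually_elim
      case (elim \<eta>)
      then have "ln (cf_d \<alpha> (Suc (K \<eta>))) \<le> ln \<eta>"
        using K(1)[of \<eta>] cf_d_pos[OF \<alpha>] by (subst ln_le_cancel_iff) auto
      then show ?case using elim by (intro divide_right_mono) (auto simp: ln_div)
    qed
  qed
  let ?I = "\<lambda>\<eta>. LBINT \<epsilon>=\<eta>..1. signed_value \<alpha> s \<epsilon>" and ?S = "\<lambda>n. \<Sum>i<n. s (Suc i) * block i \<alpha>"
  have err: "((\<lambda>\<eta>. (?I \<eta> - ?S (Suc (K \<eta>))) / real (Suc (K \<eta>))) \<longlongrightarrow> 0) (at_right 0)"
  proof (rule tendsto_0_le[where K = 1])
    have "(\<lambda>k. B * (- ln (cf_d \<alpha> (Suc k)) / real (Suc k) - (- ln (cf_d \<alpha> k) / real (Suc k)))) \<longlonglongrightarrow> B * (c - c)"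
      by (intro tendsto_intros c0 c1)
    from filterlim_compose[OF this Klim]
    show "((\<lambda>\<eta>. B * (- ln (cf_d \<alpha> (Suc (K \<eta>))) / real (Suc (K \<eta>)) - (- ln (cf_d \<alpha> (K \<eta>)) / real (Suc (K \<eta>))))) \<longlongrightarrow> 0) (at_right 0)"
      by simp
    show "eventually (\<lambda>\<eta>. norm ((?I \<eta> - ?S (Suc (K \<eta>))) / real (Suc (K \<eta>)))
      \<le> norm (B * (- ln (cf_d \<alpha> (Suc (K \<eta>))) / real (Suc (K \<eta>)) - (- ln (cf_d \<alpha> (K \<eta>)) / real (Suc (K \<eta>))))) * 1) (at_right 0)"
      using ev01
    proof eventually_elim
      case (elim \<eta>)
      have "norm ((?I \<eta> - ?S (Suc (K \<eta>))) / real (Suc (K \<eta>))) = \<bar>?I \<eta> - ?S (Suc (K \<eta>))\<bar> / real (Suc (K \<eta>))"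
        by (simp only: real_norm_def abs_divide abs_of_nat)
      also have "\<dots> \<le> B * (ln (cf_d \<alpha> (K \<eta>)) - ln (cf_d \<alpha> (Suc (K \<eta>)))) / real (Suc (K \<eta>))"
        using interval_signed_value_error[of \<eta> "K \<eta>"] K[of \<eta>] elim by (intro divide_right_mono) auto
      also have "\<dots> = B * (- ln (cf_d \<alpha> (Suc (K \<eta>))) / real (Suc (K \<eta>)) - (- ln (cf_d \<alpha> (K \<eta>)) / real (Suc (K \<eta>))))"
        by (simp only: times_divide_eq_right[symmetric] diff_divide_distrib[symmetric]) simp
      finally show ?case unfolding mult_1_right real_norm_def by (rule order_trans[OF _ abs_ge_self])
    qed
  qed
  have "((\<lambda>\<eta>. ((?I \<eta> - ?S (Suc (K \<eta>))) / real (Suc (K \<eta>)) + ?S (Suc (K \<eta>)) / real (Suc (K \<eta>)))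
      / (ln (1 / \<eta>) / real (Suc (K \<eta>)))) \<longlongrightarrow> (0 + \<Lambda>) / c) (at_right 0)"
    by (intro tendsto_divide tendsto_add err ln_lim filterlim_compose[OF LIMSEQ_Suc[OF blocks] Klim])
      (use c(2) in simp)
  moreover have "((?I \<eta> - ?S (Suc (K \<eta>))) / real (Suc (K \<eta>)) + ?S (Suc (K \<eta>)) / real (Suc (K \<eta>)))
      / (ln (1 / \<eta>) / real (Suc (K \<eta>))) = (1 / ln (1 / \<eta>)) * ?I \<eta>" for \<eta>
    by (simp only: add_divide_distrib[symmetric] diff_add_cancel) simp
  ultimately show ?thesis by (simp only: add_0)
qed

end

section \<open>Limits for almost every \<alpha>\<close>

lemma AE_limits:
  "AE \<alpha> in gauss_measure. \<alpha> \<in> unit_irrationals \<longrightarrow>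
    (\<lambda>n. - ln (cf_d \<alpha> n) / real n) \<longlonglongrightarrow> (\<integral>x. - ln x \<partial>gauss_measure) \<and>
    (\<lambda>n. (\<Sum>i<n. block i \<alpha>) / real n) \<longlonglongrightarrow> (\<integral>x. block m x \<partial>gauss_measure) \<and>
    (\<lambda>n. (\<Sum>i<n. (-1) ^ Suc i * block i \<alpha>) / real n) \<longlonglongrightarrow> 0"
  using gauss.birkhoff[OF integrable_neg_ln] gauss.birkhoff[OF block_integrable] gauss_sq.birkhoff[OF block_integrable]
proof (eventually_elim, intro impI conjI)
  fix \<alpha>
  assume ln: "(\<lambda>n. (\<Sum>i<n. - ln ((gauss_map ^^ i) \<alpha>)) / real n) \<longlonglongrightarrow> (\<integral>x. - ln x \<partial>gauss_measure)"
    and all: "(\<lambda>n. (\<Sum>i<n. block m ((gauss_map ^^ i) \<alpha>)) / real n) \<longlonglongrightarrow> (\<integral>x. block m x \<partial>gauss_measure)"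
    and ev: "(\<lambda>n. (\<Sum>i<n. block m (((gauss_map ^^ 2) ^^ i) \<alpha>)) / real n) \<longlonglongrightarrow> (\<integral>x. block m x \<partial>gauss_measure)"
    and a: "\<alpha> \<in> unit_irrationals"
  show "(\<lambda>n. - ln (cf_d \<alpha> n) / real n) \<longlonglongrightarrow> (\<integral>x. - ln x \<partial>gauss_measure)"
    using ln by (simp only: ln_cf_d[OF a])
  show "(\<lambda>n. (\<Sum>i<n. block i \<alpha>) / real n) \<longlonglongrightarrow> (\<integral>x. block m x \<partial>gauss_measure)"
    by (rule cesaro_shift[OF all]) (rule block_shift[OF a])
  have "(\<lambda>n. (\<Sum>i<n. (-1) ^ i * block m ((gauss_map ^^ i) \<alpha>)) / real n) \<longlonglongrightarrow> 0"
    by (rule alternating_cesaro[OF all]) (use ev in \<open>simp add: funpow_mult\<close>)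
  \<comment> \<open>Block i has N = i + 1, hence the exponent \<open>Suc i\<close>. Shifting the
    index by m then multiplies all signs by one constant, (-1)^(m+1).\<close>
  from tendsto_mult[OF tendsto_const[of "(-1) ^ Suc m"] this]
  have "(\<lambda>n. (\<Sum>i<n. (-1) ^ Suc (i + m) * block m ((gauss_map ^^ i) \<alpha>)) / real n) \<longlonglongrightarrow> 0"
    by (simp add: sum_distrib_left power_add mult_ac sum_negf)
  then show "(\<lambda>n. (\<Sum>i<n. (-1) ^ Suc i * block i \<alpha>) / real n) \<longlonglongrightarrow> 0"
    by (rule cesaro_shift[where k = m]) (simp only: block_shift[OF a])
qed

end

theorem theorem4p2:
  fixes m :: nat and f :: "(nat \<Rightarrow> real) \<Rightarrow> real"
  assumes meas: "f \<in> borel_measurable (PiM {..m} (\<lambda>_. restrict_space borel {0::real..}))"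
    and bnd: "\<exists>B. \<forall>x \<in> space (PiM {..m} (\<lambda>_. restrict_space borel {0::real..})). \<bar>f x\<bar> \<le> B"
  shows "\<exists>L::real. AE \<alpha> in lborel. \<alpha> \<in> {0<..<1} \<longrightarrow>
     (((\<lambda>\<eta>. (1 / ln (1 / \<eta>)) *
         (LBINT \<epsilon>=\<eta>..1. f (delta_vec m \<alpha> \<epsilon>) / \<epsilon>)) \<longlongrightarrow> L) (at_right 0) \<and>
      ((\<lambda>\<eta>. (1 / ln (1 / \<eta>)) *
         (LBINT \<epsilon>=\<eta>..1. (-1) ^ cf_N \<alpha> \<epsilon> * f (delta_vec m \<alpha> \<epsilon>) / \<epsilon>)) \<longlongrightarrow> 0) (at_right 0))"
proof -
  from bnd obtain B where "\<forall>x \<in> space (PiM {..m} (\<lambda>_. restrict_space borel {0::real..})). \<bar>f x\<bar> \<le> B" ..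
  with meas interpret delta_function m f B by unfold_locales auto
  let ?c = "\<integral>x. - ln x \<partial>gauss_measure" and ?\<Lambda> = "\<integral>x. block m x \<partial>gauss_measure"
  have ev: "eventually (\<lambda>\<eta>::real. 0 < \<eta> \<and> \<eta> < 1) (at_right 0)"
    unfolding eventually_at_right_field by (rule exI[of _ 1]) auto
  \<comment> \<open>Only \<epsilon> > 0 occurs in the range of integration, and there the absolute
    value in \<open>delta_row\<close> has no effect.\<close>
  have eq: "(LBINT \<epsilon>=\<eta>..1. s (cf_N \<alpha> \<epsilon>) * f (delta_vec m \<alpha> \<epsilon>) / \<epsilon>) = (LBINT \<epsilon>=\<eta>..1. signed_value \<alpha> s \<epsilon>)"
    if "\<alpha> \<in> unit_irrationals" "\<And>n. \<bar>s n\<bar> \<le> 1" "0 < \<eta> \<and> \<eta> < 1" for \<alpha> s and \<eta> :: real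
  proof (rule interval_integral_cong)
    fix \<epsilon> assume "\<epsilon> \<in> einterval (min (ereal \<eta>) 1) (max (ereal \<eta>) 1)"
    then have "0 < \<epsilon>" using that(3) by (auto simp: einterval_def min_def split: if_splits)
    then show "s (cf_N \<alpha> \<epsilon>) * f (delta_vec m \<alpha> \<epsilon>) / \<epsilon> = signed_value \<alpha> s \<epsilon>"
      by (simp add: signed_value_def delta_vec_eq_row row_value_def)
  qed
  have "AE \<alpha> in lborel. \<alpha> \<in> {0<..<1} \<longrightarrow>
     (((\<lambda>\<eta>. (1 / ln (1 / \<eta>)) * (LBINT \<epsilon>=\<eta>..1. f (delta_vec m \<alpha> \<epsilon>) / \<epsilon>)) \<longlongrightarrow> ?\<Lambda> / ?c) (at_right 0) \<and>
      ((\<lambda>\<eta>. (1 / ln (1 / \<eta>)) *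
         (LBINT \<epsilon>=\<eta>..1. (-1) ^ cf_N \<alpha> \<epsilon> * f (delta_vec m \<alpha> \<epsilon>) / \<epsilon>)) \<longlongrightarrow> 0) (at_right 0))"
    using AE_limits[unfolded AE_gauss_measure] AE_unit_irrationals
  proof (eventually_elim, intro impI conjI)
    fix \<alpha> :: real
    assume H: "\<alpha> \<in> {0<..<1} \<longrightarrow> \<alpha> \<in> unit_irrationals \<longrightarrow>
      (\<lambda>n. - ln (cf_d \<alpha> n) / real n) \<longlonglongrightarrow> ?c \<and>
      (\<lambda>n. (\<Sum>i<n. block i \<alpha>) / real n) \<longlonglongrightarrow> ?\<Lambda> \<and>
      (\<lambda>n. (\<Sum>i<n. (-1) ^ Suc i * block i \<alpha>) / real n) \<longlonglongrightarrow> 0"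
      "\<alpha> \<in> {0<..<1} \<longrightarrow> \<alpha> \<in> unit_irrationals" "\<alpha> \<in> {0<..<1}"
    then have a: "\<alpha> \<in> unit_irrationals" and c: "(\<lambda>n. - ln (cf_d \<alpha> n) / real n) \<longlonglongrightarrow> ?c"
      and l: "(\<lambda>n. (\<Sum>i<n. block i \<alpha>) / real n) \<longlonglongrightarrow> ?\<Lambda>"
      and l': "(\<lambda>n. (\<Sum>i<n. (-1) ^ Suc i * block i \<alpha>) / real n) \<longlonglongrightarrow> 0" by blast+
    \<comment> \<open>Both claims are instances: weight 1 with K the mean of \<open>block m\<close>,
      and alternating weight with K = 0.\<close>
    have lim: "((\<lambda>\<eta>. (1 / ln (1 / \<eta>)) * (LBINT \<epsilon>=\<eta>..1. s (cf_N \<alpha> \<epsilon>) * f (delta_vec m \<alpha> \<epsilon>) / \<epsilon>)) \<longlongrightarrow> K / ?c) (at_right 0)"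
      if s: "\<And>n. \<bar>s n\<bar> \<le> 1" and K: "(\<lambda>n. (\<Sum>i<n. s (Suc i) * block i \<alpha>) / real n) \<longlonglongrightarrow> K" for s K
    proof -
      have "eventually (\<lambda>\<eta>. (1 / ln (1 / \<eta>)) * (LBINT \<epsilon>=\<eta>..1. signed_value \<alpha> s \<epsilon>)
          = (1 / ln (1 / \<eta>)) * (LBINT \<epsilon>=\<eta>..1. s (cf_N \<alpha> \<epsilon>) * f (delta_vec m \<alpha> \<epsilon>) / \<epsilon>)) (at_right 0)"
        using ev
      proof eventually_elim
        case (elim \<eta>)
        show ?case by (rule arg_cong[where f = "\<lambda>x. 1 / ln (1 / \<eta>) * x", OF eq[where \<eta> = \<eta>, OF a s elim, symmetric]])
      qed
      with tendsto_signed_average[OF a s c integral_neg_ln_pos K] show ?thesis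
        by (rule Lim_transform_eventually)
    qed
    show "((\<lambda>\<eta>. (1 / ln (1 / \<eta>)) * (LBINT \<epsilon>=\<eta>..1. f (delta_vec m \<alpha> \<epsilon>) / \<epsilon>)) \<longlongrightarrow> ?\<Lambda> / ?c) (at_right 0)"
      using lim[of "\<lambda>_. 1" ?\<Lambda>] l by simp
    show "((\<lambda>\<eta>. (1 / ln (1 / \<eta>)) *
         (LBINT \<epsilon>=\<eta>..1. (-1) ^ cf_N \<alpha> \<epsilon> * f (delta_vec m \<alpha> \<epsilon>) / \<epsilon>)) \<longlongrightarrow> 0) (at_right 0)"
      using lim[of "\<lambda>n. (-1) ^ n" 0] l' by (simp add: power_abs)
  qed
  then show ?thesis by blast
qed

end
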